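(* Let $a\ge1$ be an integer. For complex $X$ with $|X|<1$, \begin{align*} &-2\sum_{b=1}^{\infty}\sum_{k=1}^{b}\frac{B_{b-k}}{(b-k)!}(-\pi i)^{b-k-1}\,T(\{1\}^{a-1},k+1)\,X^b\\ &=\frac{i^{a-1}}{(a-1)!}X\csc\Big(\frac{\pi X}{2}\Big)\int_0^{\pi/2}\theta^{a-1}e^{-X\log\tan(\theta/2)}\,d\theta +\frac{i}{a!}\int_0^{\pi/2}\frac{2X^2e^{-i\theta X}}{e^{-\pi iX}-1}\Big(\frac{\pi}{2}i-\log\tan\frac{\theta}{2}\Big)^{a}d\theta\\ &\quad+i\,\frac{(i\pi/2)^a}{a!}X\csc\Big(\frac{\pi X}{2}\Big), \end{align*} where $B_k$ denotes the $k$-th Bernoulli number (and $X\csc(\pi X/2)$ is understood as its continuous extension at $X=0$).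
   Context: $\{1\}^{m}$ denotes $m$ repetitions of $1$. Multiple $T$-values: for $\mathbf{k}=(k_1,\dots,k_n)\in\mathbb{Z}_{\ge1}^n$ with $k_n\ge2$, $T(\mathbf{k})=2^n\sum_{0<m_1<\cdots<m_n,\ m_j\equiv j \bmod 2} m_1^{-k_1}\cdots m_n^{-k_n}$. Bernoulli numbers: $X/(e^X-1)=\sum_{k\ge0}B_kX^k/k!$. *)

theory Defs
  imports
    "HOL-Analysis.Analysis"
    "HOL-Computational_Algebra.Formal_Power_Series"
begin

(* The summation range 0 < m_1 < ... < m_n with m_j = j (mod 2). Lists are indexed from 0,
   so m_j is "ms ! (j - 1)". *)
definition mtv_indices :: "nat \<Rightarrow> nat list set" where
  "mtv_indices n =
     {ms. length ms = n \<and> sorted_wrt (<) ms \<and>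
          (\<forall>j<n. 0 < ms ! j \<and> ms ! j mod 2 = Suc j mod 2)}"

(* Meaningful for positive entries with last entry at least 2, where the (unordered) sum of
   nonnegative terms converges; elsewhere infsum may return its default value 0. *)
definition mtv :: "nat list \<Rightarrow> real" where
  "mtv ks = 2 ^ length ks *
     (\<Sum>\<^sub>\<infinity>ms\<in>mtv_indices (length ks). \<Prod>j<length ks. 1 / real (ms ! j) ^ (ks ! j))"

(* Coefficients of X / (exp X - 1), so that the value at 1 is -1/2. Division of formal power
   series over a field cancels the common factor X. *)
definition bernoulli_num :: "nat \<Rightarrow> real" where
  "bernoulli_num k = fact k * fps_nth (fps_X / (fps_exp 1 - 1)) k"

lemma bernoulli_num_generating_function:
  "Abs_fps (\<lambda>k. bernoulli_num k / fact k) * (fps_exp 1 - 1) = fps_X"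
proof -
  have sub: "subdegree (fps_exp (1::real) - 1) = 1"
    by (rule subdegreeI) auto
  hence "fps_exp (1::real) - 1 dvd fps_X"
    by (subst fps_dvd_iff) auto
  moreover have "Abs_fps (\<lambda>k. bernoulli_num k / fact k) = fps_X / (fps_exp 1 - 1)"
    by (simp add: fps_eq_iff bernoulli_num_def)
  ultimately show ?thesis
    by simp
qed

(* X csc(pi X / 2), continuously extended to X = 0. The zeros of the sine at the other even
   integers are genuine poles and lie outside the unit disc. *)
definition X_csc :: "complex \<Rightarrow> complex" where
  "X_csc X = (if X = 0 then 2 / of_real pi else X / sin (of_real pi * X / 2))"

lemma isCont_X_csc_0: "isCont X_csc 0"
proof -
  have "((\<lambda>X::complex. sin (of_real pi * X / 2)) has_field_derivative of_real pi / 2) (at 0)"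
    by (auto intro!: derivative_eq_intros)
  hence "((\<lambda>X::complex. sin (of_real pi * X / 2) / X) \<longlongrightarrow> of_real pi / 2) (at 0)"
    by (simp add: has_field_derivative_iff)
  hence "((\<lambda>X::complex. inverse (sin (of_real pi * X / 2) / X)) \<longlongrightarrow> inverse (of_real pi / 2)) (at 0)"
    by (rule tendsto_inverse) simp
  moreover have "\<forall>\<^sub>F X in at 0. inverse (sin (of_real pi * X / 2) / X) = X_csc X"
    by (auto simp: eventually_at_filter X_csc_def)
  ultimately have "(X_csc \<longlongrightarrow> inverse (of_real pi / 2)) (at 0)"
    by (rule Lim_transform_eventually)
  thus ?thesis
    by (simp add: isCont_def X_csc_def)
qed

end

theory Submission
  imports Defs "HOL-Complex_Analysis.Complex_Analysis"
begin

text \<open>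
  Put $L(z) = \log\frac{1+z}{1-z}$ and write $L(z)^a/a! = \sum_m c_m z^m$; then
  $T(\{1\}^{a-1},k+1) = \sum_m c_m m^{-k}$. Let $P(z) = \sum_m \frac{c_m}{m-X} z^m$, which is
  continuous on the closed unit disc because $c_m = O(m^{-1/2})$. It satisfies
  $z P' - X P = L^a/a!$, so $z^{-X} P(z)$ is a primitive of $z^{-X-1} L(z)^a/a!$.
  The generating function of the $T$-values is $\sum_{k\ge1} T(\{1\}^{a-1},k+1) X^k = X P(1)$.
  Integrating along the unit arc from $1$ to $\mathrm{i}$, where
  $L(e^{\mathrm{i}\theta}) = \frac{\pi}{2}\mathrm{i} - \log\tan\frac{\theta}{2}$, expresses $P(1)$ through
  $P(\mathrm{i})$ and the second integral. Integrating along the segment from $0$ to $\mathrm{i}$, where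
  $L(\mathrm{i}\tan\frac{\theta}{2}) = \mathrm{i}\theta$, gives $P(\mathrm{i})$ through the first integral.
  It remains to multiply with the Bernoulli generating function at $-\pi\mathrm{i}X$.
\<close>

subsection \<open>Power series coefficients and multiple T-values\<close>

text \<open>\<open>mtcoeff a m\<close> is the coefficient $c_m$; the sum over $m_1 < \dots < m_a = m$ is unfolded from its largest index.\<close>
fun mtcoeff :: "nat \<Rightarrow> nat \<Rightarrow> real" where
  "mtcoeff 0 m = (if m = 0 then 1 else 0)"
| "mtcoeff (Suc a) m =
     (if 0 < m \<and> m mod 2 = Suc a mod 2 then 2 / real m * (\<Sum>j<m. mtcoeff a j) else 0)"

lemma mtcoeff_nonneg: "mtcoeff a m \<ge> 0"
  by (induction a arbitrary: m) (auto intro!: sum_nonneg divide_nonneg_nonneg)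

lemma mtcoeff_parity: "mtcoeff a m \<noteq> 0 \<Longrightarrow> m mod 2 = a mod 2"
  by (cases a) (auto split: if_splits)

lemma mtcoeff_0: "a > 0 \<Longrightarrow> mtcoeff a 0 = 0"
  by (cases a) auto

text \<open>The admissible prefixes of an index list whose largest entry is \<open>m\<close>. These
  sets are finite, so splitting off the largest entry leaves ordinary finite inner sums.\<close>

definition mtv_indices_below :: "nat \<Rightarrow> nat \<Rightarrow> nat list set" where
  "mtv_indices_below a m = {ms \<in> mtv_indices a. \<forall>x\<in>set ms. x < m}"

lemma finite_mtv_indices_below: "finite (mtv_indices_below a m)"
proof (rule finite_subset)
  show "mtv_indices_below a m \<subseteq> {ms. set ms \<subseteq> {..<m} \<and> length ms = a}"
    by (auto simp: mtv_indices_below_def mtv_indices_def)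
qed (simp add: finite_lists_length_eq)

lemma snoc_in_mtv_indices_iff:
  "ms @ [m] \<in> mtv_indices (Suc a) \<longleftrightarrow>
     0 < m \<and> m mod 2 = Suc a mod 2 \<and> ms \<in> mtv_indices_below a m"
  by (auto simp: mtv_indices_def mtv_indices_below_def sorted_wrt_append nth_append less_Suc_eq)

text \<open>Splitting off the largest index turns the sum over lists into an iterated sum that
  follows the recursion of \<open>mtcoeff\<close>.\<close>

lemma bij_betw_snoc_mtv_indices:
  "bij_betw (\<lambda>(m, ms). ms @ [m])
     (SIGMA m:{m. 0 < m \<and> m mod 2 = Suc a mod 2}. mtv_indices_below a m) (mtv_indices (Suc a))"
proof (rule bij_betw_imageI)
  show "inj_on (\<lambda>(m, ms). ms @ [m])
      (SIGMA m:{m. 0 < m \<and> m mod 2 = Suc a mod 2}. mtv_indices_below a m)"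
    by (auto simp: inj_on_def)
  have "ms \<in> (\<lambda>(m, ms). ms @ [m]) `
      (SIGMA m:{m. 0 < m \<and> m mod 2 = Suc a mod 2}. mtv_indices_below a m)"
    if ms: "ms \<in> mtv_indices (Suc a)" for ms
  proof -
    have "ms \<noteq> []"
      using ms by (auto simp: mtv_indices_def)
    then obtain xs x where "ms = xs @ [x]"
      by (cases ms rule: rev_cases) auto
    with ms show ?thesis
      by (auto simp: snoc_in_mtv_indices_iff image_iff)
  qed
  then show "(\<lambda>(m, ms). ms @ [m]) `
      (SIGMA m:{m. 0 < m \<and> m mod 2 = Suc a mod 2}. mtv_indices_below a m) = mtv_indices (Suc a)"
    by (auto simp: snoc_in_mtv_indices_iff)
qed

text \<open>Induction on the length, splitting off the largest index. The power of 2 in front of a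
  T-value is spread as one factor 2 per index. With \<open>m > 0\<close> the base case works: the
  empty product 1 is the coefficient of order 0 at index 0.\<close>

lemma sum_mtv_indices_below:
  assumes "m > 0"
  shows "(\<Sum>ms\<in>mtv_indices_below a m. \<Prod>j<a. 2 / real (ms ! j)) = (\<Sum>j<m. mtcoeff a j)"
  using assms
proof (induction a arbitrary: m)
  case 0
  have "mtv_indices_below 0 m = {[]}"
    by (auto simp: mtv_indices_below_def mtv_indices_def)
  with 0 show ?case
    by (simp add: sum.delta)
next
  case (Suc a)
  let ?A = "{j. j < m \<and> 0 < j \<and> j mod 2 = Suc a mod 2}"
  let ?f = "\<lambda>ms::nat list. \<Prod>j<a. 2 / real (ms ! j)"
  have bij: "bij_betw (\<lambda>(m, ms). ms @ [m]) (SIGMA j:?A. mtv_indices_below a j) (mtv_indices_below (Suc a) m)"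
  proof (rule bij_betw_subset[OF bij_betw_snoc_mtv_indices[of a], THEN bij_betw_cong[THEN iffD1, rotated]])
    show "(SIGMA j:?A. mtv_indices_below a j)
        \<subseteq> (SIGMA m:{m. 0 < m \<and> m mod 2 = Suc a mod 2}. mtv_indices_below a m)" by auto
    have "ms \<in> (\<lambda>(m, ms). ms @ [m]) ` (SIGMA j:?A. mtv_indices_below a j)"
      if ms: "ms \<in> mtv_indices_below (Suc a) m" for ms
    proof -
      have "ms \<noteq> []"
        using ms by (auto simp: mtv_indices_below_def mtv_indices_def)
      then obtain xs x where "ms = xs @ [x]"
        by (cases ms rule: rev_cases) auto
      with ms show ?thesis
        by (auto simp: mtv_indices_below_def[of "Suc a"] snoc_in_mtv_indices_iff image_iff)
    qed
    then show "(\<lambda>(m, ms). ms @ [m]) ` (SIGMA j:?A. mtv_indices_below a j) = mtv_indices_below (Suc a) m"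
      by (auto simp: mtv_indices_below_def[of "Suc a"] snoc_in_mtv_indices_iff)
         (auto simp: mtv_indices_below_def)
  qed simp
  have len: "length ms = a" if "ms \<in> mtv_indices_below a j" for ms j
    using that by (auto simp: mtv_indices_below_def mtv_indices_def)
  have "(\<Sum>ms\<in>mtv_indices_below (Suc a) m. \<Prod>j<Suc a. 2 / real (ms ! j))
      = (\<Sum>(j, ms)\<in>(SIGMA j:?A. mtv_indices_below a j). \<Prod>i<Suc a. 2 / real ((ms @ [j]) ! i))"
    by (subst sum.reindex_bij_betw[OF bij, symmetric]) (simp add: case_prod_unfold)
  also have "\<dots> = (\<Sum>(j, ms)\<in>(SIGMA j:?A. mtv_indices_below a j). 2 / real j * ?f ms)"
    by (intro sum.cong) (auto simp: len nth_append)
  also have "\<dots> = (\<Sum>j\<in>?A. 2 / real j * (\<Sum>ms\<in>mtv_indices_below a j. ?f ms))"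
    by (subst sum.Sigma[symmetric]) (auto simp: finite_mtv_indices_below sum_distrib_left)
  also have "\<dots> = (\<Sum>j\<in>?A. 2 / real j * (\<Sum>i<j. mtcoeff a i))"
    using Suc.IH by (intro sum.cong) auto
  \<comment> \<open>Coefficients at 0 or at an index of the wrong parity vanish, so the range may be
    enlarged.\<close>
  also have "\<dots> = (\<Sum>j<m. mtcoeff (Suc a) j)"
    by (intro sum.mono_neutral_cong_left) auto
  finally show ?case .
qed

section \<open>Size of the coefficients\<close>

lemma sum_inverse_sqrt_le: "(\<Sum>j<m. 1 / sqrt (real j)) \<le> 2 * sqrt (real m)"
proof -
  have "(\<Sum>j\<le>n. 1 / sqrt (real j)) \<le> 2 * sqrt (real n)" for n
  proof (induction n)
    case (Suc n)
    \<comment> \<open>Multiplied by \<open>u\<close>, the claim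
      \<open>1 / u \<le> 2 * (u - v)\<close> becomes the nonnegativity of the square of
      \<open>u - v\<close>, because \<open>1 = u * u - v * v\<close>. The term at index 0 is 1 / 0 =
      0.\<close>
    define u v where "u = sqrt (real (Suc n))" and "v = sqrt (real n)"
    have "u > 0" "u\<^sup>2 = v\<^sup>2 + 1"
      by (auto simp: u_def v_def)
    moreover have "(u - v)\<^sup>2 \<ge> 0"
      by simp
    ultimately have "1 / u \<le> 2 * (u - v)"
      by (simp add: field_simps power2_eq_square)
    with Suc show ?case
      by (simp add: u_def v_def)
  qed simp
  from this[of m] show ?thesis
    by (rule order_trans[rotated]) (auto intro!: sum_mono2)
qed

text \<open>The exponent 1/2 reproduces itself: summing \<open>K / sqrt j\<close> gives order
  \<open>sqrt m\<close>, and the factor \<open>2 / m\<close> of the recursion restores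
  \<open>1 / sqrt m\<close>. This absorbs all logarithms and still makes
  \<open>mtcoeff a m / m\<close> summable.\<close>

lemma mtcoeff_le: "\<exists>K\<ge>0. \<forall>m>0. mtcoeff a m \<le> K / sqrt (real m)"
proof (induction a)
  case 0
  show ?case by (intro exI[of _ 0]) auto
next
  case (Suc a)
  then obtain K where K: "K \<ge> 0" "\<And>m. m > 0 \<Longrightarrow> mtcoeff a m \<le> K / sqrt (real m)"
    by blast
  \<comment> \<open>The extra summand accounts for \<open>mtcoeff 0 0 = 1\<close>, since
    \<open>K / sqrt 0\<close> is 0 by convention.\<close>
  have le: "mtcoeff a m \<le> (if m = 0 then 1 else 0) + K * (1 / sqrt (real m))" for m
    using K(2)[of m] by (cases "m = 0"; cases a) auto
  have "mtcoeff (Suc a) m \<le> (4 * K + 2) / sqrt (real m)" if "m > 0" for m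
  proof -
    have "(\<Sum>j<m. mtcoeff a j) \<le> (\<Sum>j<m. (if j = 0 then 1 else 0) + K * (1 / sqrt (real j)))"
      by (intro sum_mono le)
    also have "\<dots> = 1 + K * (\<Sum>j<m. 1 / sqrt (real j))"
      using that by (simp add: sum.distrib sum_distrib_left)
    also have "\<dots> \<le> 1 + K * (2 * sqrt (real m))"
      using K(1) by (intro add_left_mono mult_left_mono sum_inverse_sqrt_le)
    also have "\<dots> \<le> (2 * K + 1) * sqrt (real m)"
      using that by (simp add: algebra_simps)
    finally have "mtcoeff (Suc a) m \<le> 2 / real m * ((2 * K + 1) * sqrt (real m))"
      using K(1) by (auto intro!: divide_right_mono)
    also have "\<dots> = (4 * K + 2) * (sqrt (real m) / real m)"
      by (simp add: algebra_simps add_divide_distrib)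
    also have "sqrt (real m) / real m = 1 / sqrt (real m)"
      using that by (simp add: field_simps)
    finally show ?thesis by simp
  qed
  with K(1) show ?case
    by (intro exI[of _ "4 * K + 2"]) auto
qed

lemma summable_mtcoeff_div: "summable (\<lambda>m. mtcoeff a m / real m)"
proof -
  obtain K where K: "K \<ge> 0" "\<And>m. m > 0 \<Longrightarrow> mtcoeff a m \<le> K / sqrt (real m)"
    using mtcoeff_le[of a] by blast
  have "summable (\<lambda>m. K * real m powr (-3/2))"
    by (intro summable_mult) (simp add: summable_real_powr_iff)
  then show ?thesis
  proof (rule summable_comparison_test')
    fix m :: nat assume "m \<ge> 1"
    then have "mtcoeff a m / real m \<le> K / sqrt (real m) / real m"
      by (intro divide_right_mono K) auto
    also have "\<dots> = K * real m powr (-3/2)"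
      using \<open>m \<ge> 1\<close> powr_add[of "real m" "1/2" 1]
      by (simp add: powr_minus_divide powr_half_sqrt)
    finally show "norm (mtcoeff a m / real m) \<le> K * real m powr (-3/2)"
      by (simp add: mtcoeff_nonneg)
  qed
qed

text \<open>Group the defining sum by its largest index \<open>m\<close>: of the factor
  \<open>1 / m ^ (k + 1)\<close> one power goes into the coefficient and \<open>k\<close> powers
  remain. All terms are nonnegative, so summability of the grouped series gives summability over the
  lists.\<close>

lemma mtv_ones_sums:
  assumes "a > 0" "k > 0"
  shows "(\<lambda>m. mtcoeff a m / real m ^ k) sums mtv (replicate (a - 1) 1 @ [k + 1])"
proof -
  obtain b where a: "a = Suc b"
    using assms(1) gr0_implies_Suc by blast
  let ?M = "{m. 0 < m \<and> m mod 2 = Suc b mod 2}"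
  let ?f = "\<lambda>ms::nat list. \<Prod>j<Suc b. 1 / real (ms ! j) ^ ((replicate b 1 @ [k + 1]) ! j)"
  let ?g = "\<lambda>(m, ms). 2 ^ Suc b * ?f (ms @ [m])"
  have summable: "summable (\<lambda>m. mtcoeff a m / real m ^ k)"
  proof (rule summable_comparison_test'[OF summable_mtcoeff_div[of a]])
    fix m :: nat assume "m \<ge> 1"
    then have "real m ^ 1 \<le> real m ^ k"
      using assms(2) by (intro power_increasing) auto
    then show "norm (mtcoeff a m / real m ^ k) \<le> mtcoeff a m / real m"
      using \<open>m \<ge> 1\<close> by (auto simp: mtcoeff_nonneg intro!: divide_left_mono)
  qed
  then have hs: "((\<lambda>m. mtcoeff a m / real m ^ k) has_sum (\<Sum>m. mtcoeff a m / real m ^ k)) UNIV"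
    by (intro sums_nonneg_imp_has_sum summable_sums) (auto simp: mtcoeff_nonneg)
  then have hs': "((\<lambda>m. mtcoeff a m / real m ^ k) has_sum (\<Sum>m. mtcoeff a m / real m ^ k)) ?M"
    by (rule has_sum_cong_neutral[THEN iffD1, rotated -1]) (auto simp: a)
  have inner: "((\<lambda>ms. ?g (m, ms)) has_sum (mtcoeff a m / real m ^ k)) (mtv_indices_below b m)"
    if m: "m \<in> ?M" for m
  proof -
    have len: "length ms = b" if "ms \<in> mtv_indices_below b j" for ms j
      using that by (auto simp: mtv_indices_below_def mtv_indices_def)
    have "(\<Sum>ms\<in>mtv_indices_below b m. ?g (m, ms))
        = (\<Sum>ms\<in>mtv_indices_below b m. 2 / real m ^ (k + 1) * (\<Prod>j<b. 2 / real (ms ! j)))"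
      by (intro sum.cong) (auto simp: nth_append len prod_dividef)
    also have "\<dots> = mtcoeff a m / real m ^ k"
      unfolding sum_distrib_left[symmetric] using m sum_mtv_indices_below[of m b] by (simp add: a)
    finally show ?thesis
      by (intro has_sum_finiteI finite_mtv_indices_below) auto
  qed
  have "?g summable_on (SIGMA m:?M. mtv_indices_below b m)"
    using hs' by (intro summable_on_SigmaI[where g = "\<lambda>m. mtcoeff a m / real m ^ k"] inner)
      (auto dest: has_sum_imp_summable intro!: prod_nonneg mult_nonneg_nonneg divide_nonneg_nonneg)
  with inner hs' have "(?g has_sum (\<Sum>m. mtcoeff a m / real m ^ k)) (SIGMA m:?M. mtv_indices_below b m)"
    by (intro has_sum_SigmaI[where g = "\<lambda>m. mtcoeff a m / real m ^ k"])
  then have "((\<lambda>ms. 2 ^ Suc b * ?f ms) has_sum (\<Sum>m. mtcoeff a m / real m ^ k)) (mtv_indices (Suc b))"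
    by (subst has_sum_reindex_bij_betw[OF bij_betw_snoc_mtv_indices, symmetric]) (simp add: case_prod_unfold)
  then have "mtv (replicate b 1 @ [k + 1]) = (\<Sum>m. mtcoeff a m / real m ^ k)"
    by (simp add: mtv_def infsumI flip: infsum_cmult_right')
  with summable show ?thesis
    by (simp add: a summable_sums)
qed

subsection \<open>The generating function of the coefficients\<close>

lemma summable_norm_mtcoeff_power:
  fixes z :: complex
  assumes "norm z < 1"
  shows "summable (\<lambda>m. norm (of_real (mtcoeff a m) * z ^ m))"
proof -
  obtain K where K: "K \<ge> 0" "\<And>m. m > 0 \<Longrightarrow> mtcoeff a m \<le> K / sqrt (real m)"
    using mtcoeff_le[of a] by blast
  show ?thesis
  proof (rule summable_comparison_test')
    show "summable (\<lambda>m. K * norm z ^ m)"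
      using assms by (intro summable_mult summable_geometric) auto
    fix m :: nat assume "m \<ge> 1"
    then have "mtcoeff a m \<le> K / sqrt (real m)"
      by (intro K) auto
    also have "\<dots> \<le> K / 1"
      using \<open>m \<ge> 1\<close> K(1) by (intro divide_left_mono) auto
    finally show "norm (norm (of_real (mtcoeff a m) * z ^ m)) \<le> K * norm z ^ m"
      by (auto simp: norm_mult norm_power mtcoeff_nonneg intro!: mult_right_mono)
  qed
qed

text \<open>The coefficientwise form of $(1 - z^2) F_{a+1}' = 2 F_a$ for $F_a = \sum_m c_m z^m$.\<close>
lemma mtcoeff_recurrence:
  "real (Suc m) * mtcoeff (Suc a) (Suc m) -
     (if m < 2 then 0 else real (m - 1) * mtcoeff (Suc a) (m - 1)) = 2 * mtcoeff a m"
\<comment> \<open>For equal parities both coefficients of order \<open>Suc a\<close> unfold to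
  partial sums, which differ by the entries at \<open>m - 1\<close> and \<open>m\<close>; the former
  is zero by parity. For different parities every term vanishes.\<close>
proof (cases "m mod 2 = a mod 2")
  case True
  have eq: "real (Suc m) * mtcoeff (Suc a) (Suc m) = 2 * (\<Sum>j<Suc m. mtcoeff a j)"
  proof -
    have "Suc m mod 2 = Suc a mod 2" using True by presburger
    then show ?thesis by simp
  qed
  show ?thesis
  proof (cases "m = 0")
    case False
    then obtain n where n: "m = Suc n"
      using not0_implies_Suc by blast
    have 0: "mtcoeff a n = 0"
    proof (rule ccontr)
      assume "mtcoeff a n \<noteq> 0"
      from mtcoeff_parity[OF this] True n show False by presburger
    qed
    show ?thesis
    proof (cases "n = 0")
      case True
      then show ?thesis unfolding eq using n 0 by simp
    next
      case False
      have "n mod 2 = Suc a mod 2"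
        using True n by presburger
      with False have "real n * mtcoeff (Suc a) n = 2 * (\<Sum>j<n. mtcoeff a j)"
        by simp
      then show ?thesis unfolding eq using n 0 False by simp
    qed
  qed (use eq in simp)
next
  case False
  have "Suc m mod 2 \<noteq> Suc a mod 2"
    using False by presburger
  then have 1: "mtcoeff (Suc a) (Suc m) = 0"
    using mtcoeff_parity by blast
  have 2: "mtcoeff (Suc a) (m - 1) = 0" if ge: "\<not> m < 2"
  proof -
    obtain n where n: "m = Suc n"
      using ge by (cases m) auto
    have "n mod 2 \<noteq> Suc a mod 2"
      using False unfolding n by presburger
    then have "mtcoeff (Suc a) n = 0"
      using mtcoeff_parity by blast
    then show ?thesis
      by (simp only: n diff_Suc_1)
  qed
  have 3: "mtcoeff a m = 0"
    using False mtcoeff_parity by blast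
  show ?thesis
    using 1 2 3 by (simp del: mtcoeff.simps)
qed

lemma one_minus_square_ne_0:
  fixes z :: complex
  assumes "norm z < 1"
  shows "1 - z\<^sup>2 \<noteq> 0"
proof
  assume "1 - z\<^sup>2 = 0"
  then have "norm (z\<^sup>2) = 1" by (metis eq_iff_diff_eq_0 norm_one)
  then have "(norm z)\<^sup>2 = 1" by (simp add: norm_power)
  with assms show False using norm_ge_zero[of z] unfolding power2_eq_1_iff by linarith
qed

text \<open>The map carries the disc to the right half plane, which keeps the argument of
  \<open>Ln\<close> off the branch cut.\<close>

lemma Re_moebius_div_eq:
  fixes z :: complex
  shows "Re ((1 + z) / (1 - z)) = (1 - (norm z)\<^sup>2) / (norm (1 - z))\<^sup>2"
proof -
  have "Re (1 + z) * Re (1 - z) + Im (1 + z) * Im (1 - z) = 1 - (norm z)\<^sup>2"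
    unfolding cmod_power2 by (simp add: power2_eq_square algebra_simps)
  then show ?thesis
    unfolding Re_divide cmod_power2[of "1 - z"] by (rule arg_cong)
qed

text \<open>Induction on \<open>a\<close>: the derivative of the logarithm is
  \<open>2 / (1 - z\<^sup>2)\<close>, so by the recurrence the series and the divided power have the
  same derivative on the unit ball, and both vanish at 0.\<close>

lemma mtcoeff_genfun:
  fixes z :: complex
  assumes "norm z < 1"
  shows "(\<lambda>m. of_real (mtcoeff a m) * z ^ m) sums (Ln ((1 + z) / (1 - z)) ^ a / fact a)"
proof -
  define F where "F = (\<lambda>a (z::complex). \<Sum>m. of_real (mtcoeff a m) * z ^ m)"
  have summable: "summable (\<lambda>m. of_real (mtcoeff a m) * z ^ m)" if "norm z < 1" for a and z :: complex
    using summable_norm_mtcoeff_power[OF that] by (rule summable_norm_cancel)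
  have F_deriv: "(F (Suc a) has_field_derivative 2 * F a z / (1 - z\<^sup>2)) (at z)"
    if z: "norm z < 1" for a and z :: complex
  proof -
    define d :: "nat \<Rightarrow> complex" where "d = diffs (\<lambda>m. of_real (mtcoeff (Suc a) m))"
    define D where "D = (\<Sum>m. d m * z ^ m)"
    have deriv: "(F (Suc a) has_field_derivative D) (at z)"
      unfolding F_def D_def d_def
      by (rule termdiffs_strong'[where K = 1]) (use summable z in \<open>auto simp del: mtcoeff.simps\<close>)
    have "summable (\<lambda>m. d m * z ^ m)"
      unfolding d_def by (rule termdiff_converges[where K = 1]) (use summable z in \<open>auto simp del: mtcoeff.simps\<close>)
    then have D: "(\<lambda>m. d m * z ^ m) sums D"
      by (simp add: D_def summable_sums)
    have "(\<lambda>m. (if m < 2 then 0 else d (m - 2)) * z ^ m) sums (z\<^sup>2 * D)"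
      by (subst sums_zero_iff_shift[of 2, symmetric])
         (use sums_mult[OF D, of "z\<^sup>2"] in \<open>auto simp: power_add power2_eq_square mult_ac\<close>)
    from sums_diff[OF D this]
    have "(\<lambda>m. (d m - (if m < 2 then 0 else d (m - 2))) * z ^ m) sums ((1 - z\<^sup>2) * D)"
      by (simp add: algebra_simps)
    also have "(\<lambda>m. (d m - (if m < 2 then 0 else d (m - 2))) * z ^ m) =
        (\<lambda>m. 2 * (of_real (mtcoeff a m) * z ^ m))"
    proof
      fix m
      have "d m - (if m < 2 then 0 else d (m - 2)) = of_real (real (Suc m) * mtcoeff (Suc a) (Suc m) -
          (if m < 2 then 0 else real (m - 1) * mtcoeff (Suc a) (m - 1)))"
        using Suc_diff_le[of 2 m]
        by (simp add: d_def diffs_def numeral_2_eq_2 Suc_diff_Suc del: mtcoeff.simps)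
      also have "\<dots> = of_real (2 * mtcoeff a m)"
        by (subst mtcoeff_recurrence) simp
      finally show "(d m - (if m < 2 then 0 else d (m - 2))) * z ^ m = 2 * (of_real (mtcoeff a m) * z ^ m)"
        by simp
    qed
    finally have "(1 - z\<^sup>2) * D = 2 * F a z"
      using sums_mult[OF summable_sums[OF summable[OF z, of a]], of 2]
      by (simp add: F_def sums_unique2)
    moreover have "1 - z\<^sup>2 \<noteq> 0"
      by (rule one_minus_square_ne_0[OF z])
    ultimately have "D = 2 * F a z / (1 - z\<^sup>2)"
      by (simp add: field_simps)
    with deriv show ?thesis by simp
  qed
  have L_deriv: "((\<lambda>z. Ln ((1 + z) / (1 - z))) has_field_derivative 2 / (1 - z\<^sup>2)) (at z)"
    if z: "norm z < 1" for z :: complex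
  proof -
    have ne: "1 - z \<noteq> 0" "1 + z \<noteq> 0"
      using z by (auto simp: add_eq_0_iff)
    have "Re ((1 + z) / (1 - z)) > 0"
      using z ne(1) by (simp add: Re_moebius_div_eq abs_square_less_1)
    then have "(1 + z) / (1 - z) \<notin> \<real>\<^sub>\<le>\<^sub>0"
      using complex_nonpos_Reals_iff by (metis not_le)
    moreover have "((\<lambda>z. (1 + z) / (1 - z)) has_field_derivative 2 / (1 - z)\<^sup>2) (at z)"
      by (rule derivative_eq_intros refl ne)+ (simp add: power2_eq_square)
    ultimately have "((\<lambda>z. Ln ((1 + z) / (1 - z))) has_field_derivative
        inverse ((1 + z) / (1 - z)) * (2 / (1 - z)\<^sup>2)) (at z)"
      by (rule DERIV_chain2[OF has_field_derivative_Ln])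
    moreover have "1 - z\<^sup>2 = (1 + z) * (1 - z)"
      by (simp add: algebra_simps power2_eq_square)
    then have "inverse ((1 + z) / (1 - z)) * (2 / (1 - z)\<^sup>2) = 2 / (1 - z\<^sup>2)"
      using ne by (simp add: power2_eq_square divide_inverse mult_ac)
    ultimately show ?thesis by simp
  qed
  have F_eq: "F a z = Ln ((1 + z) / (1 - z)) ^ a / fact a" if "norm z < 1" for a z
    using that
  proof (induction a arbitrary: z)
    case 0
    have eq: "(\<lambda>m. complex_of_real (mtcoeff 0 m) * z ^ m) = (\<lambda>m. if m = 0 then 1 else 0)"
      by (simp add: fun_eq_iff)
    have "F 0 z = 1"
      unfolding F_def eq using sums_single[of 0 "\<lambda>_. 1 :: complex"] by (rule sums_unique[symmetric])
    then show ?case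
      by simp
  next
    case (Suc a)
    define E where "E = (\<lambda>z. F (Suc a) z - Ln ((1 + z) / (1 - z)) ^ Suc a / fact (Suc a))"
    have "(E has_field_derivative 0) (at w within ball 0 1)" if "w \<in> ball 0 1" for w
    proof -
      have w: "norm w < 1" using that by simp
      have "((\<lambda>z. Ln ((1 + z) / (1 - z)) ^ Suc a / fact (Suc a)) has_field_derivative
          (of_nat (Suc a) * Ln ((1 + w) / (1 - w)) ^ a * (2 / (1 - w\<^sup>2))) / fact (Suc a)) (at w)"
        using DERIV_cdivide[OF DERIV_power[OF L_deriv[OF w], of "Suc a"], of "fact (Suc a)"]
        by (simp add: mult_ac)
      also have "of_nat (Suc a) * Ln ((1 + w) / (1 - w)) ^ a * (2 / (1 - w\<^sup>2)) / fact (Suc a) =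
          2 * F a w / (1 - w\<^sup>2)"
        unfolding Suc.IH[OF w] fact_Suc using of_nat_neq_0[of a, where 'a = complex]
        by (simp add: mult_ac del: of_nat_Suc)
      finally have "((\<lambda>z. Ln ((1 + z) / (1 - z)) ^ Suc a / fact (Suc a)) has_field_derivative
          2 * F a w / (1 - w\<^sup>2)) (at w)" .
      from DERIV_diff[OF F_deriv[OF w, of a] this] have "(E has_field_derivative 0) (at w)"
        by (simp only: E_def diff_self)
      then show ?thesis
        by (rule has_field_derivative_at_within)
    qed
    then obtain c where c: "\<And>w. w \<in> ball 0 1 \<Longrightarrow> E w = c"
      using has_field_derivative_zero_constant[of "ball 0 1" E] by auto
    have "F (Suc a) 0 = 0"
      unfolding F_def powser_zero by (simp only: mtcoeff_0 zero_less_Suc of_real_0)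
    then have "E 0 = 0"
      by (simp only: E_def) simp
    moreover have "E z = E 0"
      using c[of 0] c[of z] Suc.prems by simp
    ultimately show ?case
      by (simp only: E_def diff_self right_minus_eq)
  qed
  show ?thesis
    using summable_sums[OF summable[OF assms, of a]] unfolding F_eq[OF assms, of a, symmetric] F_def .
qed

subsection \<open>A Lerch-type series\<close>

text \<open>This is the function P of the overview. For \<open>a > 0\<close> the numerator at index
  0 is zero, so that term is 0 even for \<open>X = 0\<close>, where it reads 0 / 0.\<close>

definition mtlerch :: "nat \<Rightarrow> complex \<Rightarrow> complex \<Rightarrow> complex" where
  "mtlerch a X z = (\<Sum>m. of_real (mtcoeff a m) / (of_nat m - X) * z ^ m)"

context
  fixes a :: nat and X :: complex
  assumes a: "a > 0" and X: "norm X < 1"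
begin

lemma of_nat_minus_ne_0: "m > 0 \<Longrightarrow> of_nat m - X \<noteq> 0"
  using X by (metis eq_iff_diff_eq_0 gr0_conv_Suc leD norm_of_nat of_nat_Suc of_nat_0_le_iff add_increasing2 order_refl add.commute)

text \<open>For \<open>m \<ge> 1\<close> one has
  \<open>norm (of_nat m - X) \<ge> m - norm X \<ge> m * (1 - norm X)\<close>. The majorant is
  summable and independent of the point in the disc.\<close>

lemma mtlerch_coeff_bound:
  "norm (of_real (mtcoeff a m) / (of_nat m - X)) \<le> mtcoeff a m / real m / (1 - norm X)"
proof (cases "m = 0")
  case False
  then have m: "real m \<ge> 1" by simp
  have "real m * norm X \<ge> norm X * 1"
    using m by (metis mult.commute mult_right_mono norm_ge_zero)
  then have "real m * (1 - norm X) \<le> real m - norm X"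
    by (simp add: algebra_simps)
  also have "\<dots> \<le> norm (of_nat m - X)"
    using norm_triangle_ineq2[of "of_nat m" X] by simp
  finally have "mtcoeff a m / norm (of_nat m - X) \<le> mtcoeff a m / (real m * (1 - norm X))"
    using m X of_nat_minus_ne_0[of m] by (intro divide_left_mono mtcoeff_nonneg mult_pos_pos) auto
  then show ?thesis
    by (simp add: norm_divide mtcoeff_nonneg)
qed (simp add: mtcoeff_0 a)

lemma mtlerch_term_bound:
  assumes "norm z \<le> 1"
  shows "norm (of_real (mtcoeff a m) / (of_nat m - X) * z ^ m) \<le>
    mtcoeff a m / real m / (1 - norm X) * norm z"
proof (cases "m = 0")
  case False
  then have "norm z ^ m \<le> norm z ^ 1"
    using assms by (intro power_decreasing) auto
  then show ?thesis
    unfolding norm_mult norm_power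
    using mtlerch_coeff_bound[of m] X by (intro mult_mono) (auto simp: mtcoeff_nonneg)
qed (simp add: mtcoeff_0 a)

lemma summable_mtlerch_bound: "summable (\<lambda>m. mtcoeff a m / real m / (1 - norm X))"
  by (intro summable_divide summable_mtcoeff_div)

lemma summable_norm_mtlerch:
  assumes "norm z \<le> 1"
  shows "summable (\<lambda>m. norm (of_real (mtcoeff a m) / (of_nat m - X) * z ^ m))"
  by (rule summable_comparison_test'[OF summable_mult2[OF summable_mtlerch_bound, of "norm z"]])
     (use mtlerch_term_bound[OF assms] in auto)

lemma mtlerch_sums:
  assumes "norm z \<le> 1"
  shows "(\<lambda>m. of_real (mtcoeff a m) / (of_nat m - X) * z ^ m) sums mtlerch a X z"
  using summable_norm_cancel[OF summable_norm_mtlerch[OF assms]]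
  by (simp add: mtlerch_def summable_sums)

text \<open>Without a constant term the series vanishes linearly at 0; this will beat the singular
  factor \<open>t powr (- norm X)\<close> at the start of the imaginary segment.\<close>

lemma norm_mtlerch_le: "\<exists>C. \<forall>z. norm z \<le> 1 \<longrightarrow> norm (mtlerch a X z) \<le> C * norm z"
proof (intro exI allI impI)
  fix z :: complex assume z: "norm z \<le> 1"
  have "norm (mtlerch a X z) \<le> (\<Sum>m. norm (of_real (mtcoeff a m) / (of_nat m - X) * z ^ m))"
    unfolding mtlerch_def by (rule summable_norm[OF summable_norm_mtlerch[OF z]])
  also have "\<dots> \<le> (\<Sum>m. mtcoeff a m / real m / (1 - norm X) * norm z)"
    by (intro suminf_le mtlerch_term_bound z summable_norm_mtlerch summable_mult2 summable_mtlerch_bound)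
  also have "\<dots> = (\<Sum>m. mtcoeff a m / real m / (1 - norm X)) * norm z"
    by (rule suminf_mult2[symmetric]) (rule summable_mtlerch_bound)
  finally show "norm (mtlerch a X z) \<le> (\<Sum>m. mtcoeff a m / real m / (1 - norm X)) * norm z" .
qed

text \<open>The Weierstrass test reaches the boundary circle, which contains the arc of integration
  and its endpoints 1 and \<open>\<i>\<close>.\<close>

lemma continuous_on_mtlerch: "continuous_on (cball 0 1) (mtlerch a X)"
proof -
  have "uniform_limit (cball 0 1)
      (\<lambda>n z. \<Sum>m<n. of_real (mtcoeff a m) / (of_nat m - X) * z ^ m) (mtlerch a X) sequentially"
    unfolding mtlerch_def
  proof (rule Weierstrass_m_test[OF _ summable_mtlerch_bound])
    fix m and z :: complex assume z: "z \<in> cball 0 1"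
    then have "mtcoeff a m / real m / (1 - norm X) * norm z \<le> mtcoeff a m / real m / (1 - norm X)"
      using X by (intro mult_left_le) (auto simp: mtcoeff_nonneg)
    with mtlerch_term_bound[of z m] z
    show "norm (of_real (mtcoeff a m) / (of_nat m - X) * z ^ m) \<le> mtcoeff a m / real m / (1 - norm X)"
      by simp
  qed
  then show ?thesis
    by (rule uniform_limit_theorem[rotated]) (intro always_eventually allI continuous_on_sum continuous_on_mult continuous_on_const
        continuous_on_power continuous_on_id trivial_limit_sequentially)+
qed

text \<open>Multiplying the derivative by \<open>z\<close> multiplies the coefficients by
  \<open>m\<close>, and \<open>m / (m - X) = 1 + X / (m - X)\<close>. The form \<open>z * D\<close>
  avoids dividing by \<open>z\<close> at the origin.\<close>

lemma mtlerch_has_field_derivative: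
  assumes z: "norm z < 1"
  obtains D where "(mtlerch a X has_field_derivative D) (at z)"
    and "z * D = Ln ((1 + z) / (1 - z)) ^ a / fact a + X * mtlerch a X z"
proof -
  define p where "p = (\<lambda>m. of_real (mtcoeff a m) / (of_nat m - X))"
  define D where "D = (\<Sum>m. diffs p m * z ^ m)"
  have summable: "summable (\<lambda>m. p m * z ^ m)" if "norm z < 1" for z
    using summable_norm_cancel[OF summable_norm_mtlerch[of z]] that by (simp add: p_def)
  have mtlerch_eq: "mtlerch a X = (\<lambda>z. \<Sum>m. p m * z ^ m)"
    by (simp add: mtlerch_def p_def fun_eq_iff)
  have deriv: "(mtlerch a X has_field_derivative D) (at z)"
    unfolding mtlerch_eq D_def
    by (rule termdiffs_strong'[where K = 1]) (use summable z in auto)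
  have "summable (\<lambda>m. diffs p m * z ^ m)"
    by (rule termdiff_converges[where K = 1]) (use summable z in auto)
  then have "(\<lambda>m. diffs p m * z ^ m) sums D"
    by (simp add: D_def summable_sums)
  from sums_mult[OF this, of z] have "(\<lambda>m. of_nat (Suc m) * p (Suc m) * z ^ Suc m) sums (z * D)"
    by (simp add: diffs_def mult_ac)
  then have "(\<lambda>m. of_nat m * p m * z ^ m) sums (z * D)"
    by (subst (asm) sums_Suc_iff) simp
  moreover have "(\<lambda>m. of_real (mtcoeff a m) * z ^ m + X * (p m * z ^ m)) sums
      (Ln ((1 + z) / (1 - z)) ^ a / fact a + X * mtlerch a X z)"
    using mtlerch_sums[of z] z unfolding p_def
    by (intro sums_add sums_mult mtcoeff_genfun) auto
  moreover have "of_nat m * p m * z ^ m = of_real (mtcoeff a m) * z ^ m + X * (p m * z ^ m)" for m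
  proof (cases "m = 0")
    case False
    then show ?thesis
      using of_nat_minus_ne_0[of m] by (simp add: p_def field_simps)
  qed (simp add: p_def mtcoeff_0 a)
  ultimately have "z * D = Ln ((1 + z) / (1 - z)) ^ a / fact a + X * mtlerch a X z"
    by (simp add: sums_unique2)
  with deriv that show ?thesis by blast
qed

text \<open>Expand \<open>X / (m - X)\<close> as the geometric series of \<open>X / m\<close> and
  interchange the sums. The exponent \<open>Suc i\<close> is the k of the T-value, so the last entry
  is at least 2.\<close>

lemma mtv_genfun:
  defines "t \<equiv> \<lambda>i. of_real (mtv (replicate (a - 1) 1 @ [Suc i + 1])) * X ^ Suc i"
  shows "summable (\<lambda>i. norm (t i))" and "t sums (X * mtlerch a X 1)"
proof -
  define f where "f = (\<lambda>(m, i). of_real (mtcoeff a m) * (X / of_nat m) ^ Suc i)"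
  define g where "g = (\<lambda>m. X * (of_real (mtcoeff a m) / (of_nat m - X)))"
  \<comment> \<open>Stated for a general field because it is applied both to \<open>X\<close> and to
    the real number \<open>norm X\<close>; the latter supplies the absolute convergence for the
    interchange.\<close>
  have geometric: "((\<lambda>i. c * (x / of_nat m) ^ Suc i) has_sum (c * (x / (of_nat m - x)))) UNIV"
    if x: "norm x < 1" and m: "m > 0" for x c :: "'b :: {real_normed_field, banach}" and m
  proof -
    have lt: "norm (x / of_nat m) < 1"
      using x m by (auto simp: norm_divide divide_simps)
    have ne: "of_nat m \<noteq> (0 :: 'b)" using m by simp
    have "((\<lambda>i. (x / of_nat m) ^ i) has_sum (x / of_nat m / (1 - x / of_nat m))) {1..}"
      by (rule has_sum_geometric_from_1[OF lt])
    also have "x / of_nat m / (1 - x / of_nat m) = x / (of_nat m - x)"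
      using ne by (simp add: divide_simps)
    also have "{1..} = range Suc"
      by (metis atLeast_Suc_greaterThan One_nat_def greaterThan_0)
    finally have "((\<lambda>i. (x / of_nat m) ^ Suc i) has_sum (x / (of_nat m - x))) UNIV"
      by (subst (asm) has_sum_reindex) (auto simp: o_def)
    then show ?thesis
      by (rule has_sum_cmult_right)
  qed
  have f_inner: "((\<lambda>i. f (m, i)) has_sum g m) UNIV" for m
  proof (cases "m = 0")
    case False
    then show ?thesis
      using geometric[OF X, of m "of_real (mtcoeff a m)"] by (simp add: f_def g_def mult_ac)
  qed (simp add: f_def g_def mtcoeff_0 a)
  have norm_inner: "((\<lambda>i. norm (f (m, i))) has_sum (norm X * (mtcoeff a m / (real m - norm X)))) UNIV" for m
  proof (cases "m = 0")
    case False
    then show ?thesis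
      using geometric[of "norm X" m "mtcoeff a m"] X
      by (simp add: f_def norm_mult norm_power norm_divide mtcoeff_nonneg mult_ac)
  qed (simp add: f_def mtcoeff_0 a)
  have outer: "(\<lambda>m. norm X * (mtcoeff a m / (real m - norm X))) summable_on UNIV"
  proof (rule summable_nonneg_imp_summable_on)
    show "summable (\<lambda>m. norm X * (mtcoeff a m / (real m - norm X)))"
    proof (rule summable_mult, rule summable_comparison_test'[OF summable_mtlerch_bound])
      fix m :: nat assume "m \<ge> 1"
      then have m: "real m \<ge> 1" by simp
      have "real m * norm X \<ge> norm X * 1"
        using m by (metis mult.commute mult_right_mono norm_ge_zero)
      then have "real m * (1 - norm X) \<le> real m - norm X"
        by (simp add: algebra_simps)
      then have "mtcoeff a m / (real m - norm X) \<le> mtcoeff a m / (real m * (1 - norm X))"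
        using m X by (intro divide_left_mono mtcoeff_nonneg) auto
      then show "norm (mtcoeff a m / (real m - norm X)) \<le> mtcoeff a m / real m / (1 - norm X)"
        using m X by (simp add: mtcoeff_nonneg)
    qed
    show "norm X * (mtcoeff a m / (real m - norm X)) \<ge> 0" for m
      using X a by (cases "m = 0") (auto simp: mtcoeff_0 mtcoeff_nonneg intro!: mult_nonneg_nonneg divide_nonneg_nonneg)
  qed
  have "(\<lambda>x. norm (f x)) summable_on (UNIV \<times> UNIV)"
    using norm_inner outer
    by (rule summable_on_SigmaI) auto
  then have summable: "f summable_on (UNIV \<times> UNIV)"
    by (rule abs_summable_summable)
  have "(g has_sum (X * mtlerch a X 1)) UNIV"
  proof (rule norm_summable_imp_has_sum)
    show "g sums (X * mtlerch a X 1)"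
      using sums_mult[OF mtlerch_sums[of 1], of X] by (simp add: g_def)
    show "summable (\<lambda>m. norm (g m))"
      using summable_mult[OF summable_norm_mtlerch[of 1], of "norm X"]
      by (simp only: g_def norm_mult power_one mult_1_right norm_one order_refl)
  qed
  with f_inner summable have "(f has_sum (X * mtlerch a X 1)) (UNIV \<times> UNIV)"
    by (intro has_sum_SigmaI[where g = g])
  then have "((\<lambda>(i, m). f (m, i)) has_sum (X * mtlerch a X 1)) (UNIV \<times> UNIV)"
    by (subst (asm) has_sum_swap)
  moreover have "((\<lambda>m. (\<lambda>(i, m). f (m, i)) (i, m)) has_sum t i) UNIV" for i
  proof -
    have "((\<lambda>m. mtcoeff a m / real m ^ Suc i) has_sum mtv (replicate (a - 1) 1 @ [Suc i + 1])) UNIV"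
      using a by (intro sums_nonneg_imp_has_sum mtv_ones_sums) (auto simp: mtcoeff_nonneg)
    then have "((\<lambda>m. of_real (mtcoeff a m / real m ^ Suc i) * X ^ Suc i) has_sum t i) UNIV"
      unfolding t_def by (intro has_sum_cmult_left has_sum_of_real)
    then show ?thesis
      by (simp add: f_def power_divide mult_ac)
  qed
  ultimately have t: "(t has_sum (X * mtlerch a X 1)) UNIV"
    by (rule has_sum_SigmaD)
  then show "t sums (X * mtlerch a X 1)"
    by (rule has_sum_imp_sums)
  from t have "(\<lambda>i. norm (t i)) summable_on UNIV"
    using has_sum_imp_summable summable_on_iff_abs_summable_on_complex by blast
  then show "summable (\<lambda>i. norm (t i))"
    by (rule summable_on_imp_summable)
qed

end

subsection \<open>Bernoulli numbers\<close>

text \<open>The only zero of \<open>exp w - 1\<close> in the disc of radius \<open>2 * pi\<close> is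
  the simple one at 0, which the numerator cancels, so the quotient series converges there.\<close>

lemma bernoulli_genfun:
  fixes z :: complex
  assumes "norm z < 2 * pi"
  shows "summable (\<lambda>n. norm (of_real (bernoulli_num n) / fact n * z ^ n))"
    and "(\<lambda>n. of_real (bernoulli_num n) / fact n * z ^ n) sums (if z = 0 then 1 else z / (exp z - 1))"
proof -
  define B :: "complex fps" where "B = fps_X / (fps_exp 1 - 1)"
  have sub: "subdegree (fps_exp (1::complex) - 1) = 1"
    by (rule subdegreeI) auto
  then have nz: "fps_exp (1::complex) - 1 \<noteq> 0"
    by auto
  \<comment> \<open>The Bernoulli numbers are defined over the reals. The complex quotient is
    identified by transferring the product identity coefficientwise and cancelling the
    divisor.\<close>
  have B_eq: "Abs_fps (\<lambda>n. of_real (bernoulli_num n) / fact n) = B"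
  proof -
    have "Abs_fps (\<lambda>n. of_real (bernoulli_num n) / fact n) * (fps_exp (1::complex) - 1) = fps_X"
    proof (rule fps_ext)
      fix n
      have "fps_nth (Abs_fps (\<lambda>k. bernoulli_num k / fact k) * (fps_exp 1 - 1)) n = fps_nth fps_X n"
        by (simp only: bernoulli_num_generating_function)
      from arg_cong[OF this, of complex_of_real]
      show "fps_nth (Abs_fps (\<lambda>n. of_real (bernoulli_num n) / fact n) * (fps_exp (1::complex) - 1)) n =
          fps_nth fps_X n"
        by (simp add: fps_mult_nth of_real_def[symmetric] if_distrib cong: if_cong)
    qed
    then show ?thesis
      unfolding B_def using nz by (metis nonzero_mult_div_cancel_right)
  qed
  have ne: "eval_fps (fps_exp (1::complex) - 1) w \<noteq> 0" if "w \<in> eball 0 (ereal (2 * pi))" "w \<noteq> 0" for w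
  proof
    assume "eval_fps (fps_exp (1::complex) - 1) w = 0"
    then have "exp w = 1"
      by (simp add: eval_fps_diff)
    then obtain n :: int where n: "Re w = 0" "Im w = of_int (2 * n) * pi"
      unfolding exp_eq_1 by blast
    have "norm w < 2 * pi"
      using that(1) by (simp add: eball_def dist_norm)
    moreover have "norm w = \<bar>Im w\<bar>"
      using n(1) by (simp add: cmod_def)
    ultimately have "2 * pi * \<bar>of_int n\<bar> < 2 * pi * 1"
      using n(2) by (simp add: abs_mult)
    then have "\<bar>of_int n :: real\<bar> < 1"
      by (subst (asm) mult_less_cancel_left_pos) auto
    then have "n = 0" by linarith
    with n that(2) show False
      by (simp add: complex_eq_iff)
  qed
  have radius: "fps_conv_radius (fps_exp (1::complex) - 1) = \<infinity>"
    using fps_conv_radius_diff[of "fps_exp (1::complex)" 1] by simp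
  have R: "Min {ereal (2 * pi), fps_conv_radius (fps_X :: complex fps), fps_conv_radius (fps_exp (1::complex) - 1)} = 2 * pi"
    by (simp add: radius)
  have conv: "fps_conv_radius B \<ge> 2 * pi"
    unfolding B_def
  proof (subst R[symmetric], rule fps_conv_radius_divide)
  qed (use sub radius ne in auto)
  have eval: "eval_fps B z = (if z = 0 then 1 else z / (exp z - 1))"
  proof -
    have "eval_fps B z = (if z = 0 then 1 else eval_fps fps_X z / eval_fps (fps_exp 1 - 1) z)"
      unfolding B_def
    proof (rule eval_fps_divide[where r = "2 * pi"])
      show "ereal (norm z) < Min {ereal (2 * pi), fps_conv_radius (fps_X :: complex fps), fps_conv_radius (fps_exp (1::complex) - 1)}"
        unfolding R using assms by simp
    qed (use sub radius ne in auto)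
    then show ?thesis
      by (simp add: eval_fps_diff)
  qed
  have less: "ereal (norm z) < fps_conv_radius B"
    using assms conv by (meson ereal_less_eq(3) less_le_trans less_ereal.simps(1))
  have nth: "fps_nth B n = of_real (bernoulli_num n) / fact n" for n
    by (simp flip: B_eq)
  show "(\<lambda>n. of_real (bernoulli_num n) / fact n * z ^ n) sums (if z = 0 then 1 else z / (exp z - 1))"
    using sums_eval_fps[OF less] unfolding eval nth .
  show "summable (\<lambda>n. norm (of_real (bernoulli_num n) / fact n * z ^ n))"
    using abs_summable_in_conv_radius[of z "fps_nth B"] less unfolding fps_conv_radius_def nth by blast
qed

subsection \<open>Integrals along the imaginary axis and the unit arc\<close>

lemma tan_half_in_unit:
  assumes "0 < \<theta>" "\<theta> < pi / 2"
  shows "0 < tan (\<theta> / 2)" "tan (\<theta> / 2) < 1"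
  using assms tan_monotone[of "\<theta> / 2" "pi / 4"] by (auto simp: tan_45 intro!: tan_gt_zero)

lemma Ln_moebius_i_tan:
  assumes "0 < \<theta>" "\<theta> < pi / 2"
  shows "Ln ((1 + \<i> * of_real (tan (\<theta> / 2))) / (1 - \<i> * of_real (tan (\<theta> / 2)))) = \<i> * of_real \<theta>"
proof -
  have "arctan (tan (\<theta> / 2)) = \<theta> / 2"
    using assms by (intro arctan_tan) auto
  then show ?thesis
    \<comment> \<open>At \<open>- tan (\<theta> / 2)\<close> the quotient inside
      \<open>Arctan_def\<close> becomes the one wanted here.\<close>
    using Arctan_of_real[of "- tan (\<theta> / 2)"]
    by (simp add: Arctan_def arctan_minus complex_eq_iff)
qed

lemma moebius_cis:
  assumes "0 < \<theta>" "\<theta> < pi"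
  shows "(1 + cis \<theta>) / (1 - cis \<theta>) = \<i> / of_real (tan (\<theta> / 2))"
proof -
  define s c where "s = sin (\<theta> / 2)" and "c = cos (\<theta> / 2)"
  have pos: "s > 0" "c > 0"
    using assms by (auto simp: s_def c_def intro!: sin_gt_zero cos_gt_zero)
  have 1: "s * s + c * c = 1"
    using sin_cos_squared_add[of "\<theta> / 2"] by (simp add: s_def c_def power2_eq_square)
  have cos: "cos \<theta> = c * c - s * s"
    using cos_double[of "\<theta> / 2"] by (simp add: s_def c_def power2_eq_square)
  have sin: "sin \<theta> = 2 * s * c"
    using sin_double[of "\<theta> / 2"] by (simp add: s_def c_def)
  \<comment> \<open>Half-angle factorisation: \<open>Complex c s\<close> is
    \<open>cis (\<theta> / 2)\<close>, and it cancels in the quotient.\<close>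
  have "1 + cis \<theta> = 2 * of_real c * Complex c s"
    using 1 by (auto simp: complex_eq_iff cos sin)
  moreover have "1 - cis \<theta> = - 2 * \<i> * of_real s * Complex c s"
    using 1 by (auto simp: complex_eq_iff cos sin)
  moreover have "Complex c s \<noteq> 0"
    using pos by (auto simp: complex_eq_iff)
  moreover have "complex_of_real (tan (\<theta> / 2)) = of_real s / of_real c"
    by (simp add: tan_def s_def c_def)
  then have tan: "\<i> / of_real (tan (\<theta> / 2)) = \<i> * of_real c / of_real s"
    by (simp only: divide_divide_eq_right)
  ultimately show ?thesis
    unfolding tan using pos by (simp add: divide_simps)
qed

lemma Ln_moebius_cis:
  assumes "0 < \<theta>" "\<theta> \<le> pi / 2"
  shows "Ln ((1 + cis \<theta>) / (1 - cis \<theta>)) = of_real pi / 2 * \<i> - of_real (ln (tan (\<theta> / 2)))"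
proof -
  have t: "tan (\<theta> / 2) > 0"
    using assms by (intro tan_gt_zero) auto
  then have r: "1 / tan (\<theta> / 2) > 0"
    by simp
  have "Ln ((1 + cis \<theta>) / (1 - cis \<theta>)) = Ln (of_real (1 / tan (\<theta> / 2)) * \<i>)"
    using assms by (subst moebius_cis) (auto simp: field_simps)
  also have "\<dots> = of_real (ln (1 / tan (\<theta> / 2))) + Ln \<i>"
    using Ln_times_of_real[OF r, of \<i>] by (simp only: Ln_of_real[OF r] complex_i_not_zero not_False_eq_True simp_thms)
  also have "\<dots> = of_real pi / 2 * \<i> - of_real (ln (tan (\<theta> / 2)))"
    using t by (simp add: ln_div)
  finally show ?thesis .
qed

section \<open>The integral along the imaginary segment\<close>

lemma continuous_on_Icc_if_tendsto:
  fixes f :: "real \<Rightarrow> 'a :: topological_space"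
  assumes "continuous_on {a<..b} f" and "(f \<longlongrightarrow> f a) (at_right a)"
  shows "continuous_on {a..b} f"
  unfolding continuous_on_def
proof
  fix x assume x: "x \<in> {a..b}"
  show "(f \<longlongrightarrow> f x) (at x within {a..b})"
  proof (cases "x = a")
    case True
    have "at a within {a..b} \<le> at_right a"
      by (subst at_within_nhd[of _ UNIV _ "{a<..b}"]) (auto intro!: at_le)
    with assms(2) show ?thesis
      unfolding True by (rule tendsto_mono[rotated])
  next
    case False
    then have "at x within {a..b} = at x within {a<..b}"
      using x by (intro at_within_nhd[of _ "{a<..}"]) auto
    moreover have "(f \<longlongrightarrow> f x) (at x within {a<..b})"
      using assms(1) x False by (auto simp: continuous_on_def)
    ultimately show ?thesis
      by simp
  qed
qed

text \<open>The primitive is differentiated only on the open interval: the logarithm is singular at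
  0, and at \<open>pi / 2\<close> the point \<open>\<i>\<close> lies on the boundary of the disc.
  Continuity on the closed interval is enough for the fundamental theorem.\<close>

lemma has_integral_mtlerch_imaginary_axis:
  fixes X :: complex
  assumes a: "a > 0" and X: "norm X < 1"
  shows "((\<lambda>\<theta>. of_real \<theta> ^ (a - 1) * exp (- X * of_real (ln (tan (\<theta> / 2))))) has_integral
    fact (a - 1) / \<i> ^ a * (X * mtlerch a X \<i> + (\<i> * of_real pi / 2) ^ a / fact a)) {0..pi / 2}"
proof -
  define E where "E = (\<lambda>\<theta>. exp (- X * of_real (ln (tan (\<theta> / 2)))))"
  define W where "W = (\<lambda>\<theta>. (\<i> * complex_of_real \<theta>) ^ a / fact a)"
  define K where "K = (\<lambda>\<theta>. if \<theta> = 0 then 0 else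
      E \<theta> * (X * mtlerch a X (\<i> * of_real (tan (\<theta> / 2))) + W \<theta>))"
  \<comment> \<open>\<open>K\<close> is $t^{-X}(X P(\mathrm{i}t) + (\mathrm{i}\theta)^a/a!)$ at $t = \tan(\theta/2)$: the added term performs the integration by parts.\<close>
  have deriv: "(K has_vector_derivative (\<i> ^ a / fact (a - 1)) * (of_real \<theta> ^ (a - 1) * E \<theta>)) (at \<theta>)"
    if th: "\<theta> \<in> {0<..<pi / 2}" for \<theta>
  proof -
    define t where "t = tan (\<theta> / 2)"
    define t' where "t' = inverse ((cos (\<theta> / 2))\<^sup>2) * (1 / 2)"
    have t: "0 < t" "t < 1"
      using tan_half_in_unit[of \<theta>] th by (auto simp: t_def)
    have "cos (\<theta> / 2) > 0"
      using th by (intro cos_gt_zero_pi) auto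
    then have dt: "((\<lambda>\<theta>. tan (\<theta> / 2)) has_real_derivative t') (at \<theta>)"
      unfolding t'_def by (intro DERIV_chain'[of "\<lambda>\<theta>. \<theta> / 2" "1 / 2" \<theta> UNIV tan] DERIV_tan)
        (auto intro!: derivative_eq_intros)
    have Et: "E \<theta> = exp (- X * of_real (ln t))"
      by (simp add: E_def t_def)
    have "((\<lambda>\<theta>. ln (tan (\<theta> / 2))) has_real_derivative (t' / t)) (at \<theta>)"
      using DERIV_chain2[OF DERIV_ln dt] t by (simp add: t_def field_simps)
    then have "((\<lambda>\<theta>. - X * of_real (ln (tan (\<theta> / 2)))) has_vector_derivative (- X * of_real (t' / t))) (at \<theta>)"
      by (intro has_vector_derivative_mult_right has_vector_derivative_of_real)
    from field_vector_diff_chain_at[OF this DERIV_exp]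
    have dE: "(E has_vector_derivative (- X * of_real (t' / t)) * E \<theta>) (at \<theta>)"
      by (simp add: o_def E_def)
    have "norm (\<i> * of_real t) < 1"
      using t by (simp add: norm_mult)
    from mtlerch_has_field_derivative[OF a X this]
    obtain D where D: "(mtlerch a X has_field_derivative D) (at (\<i> * of_real t))"
      "\<i> * of_real t * D = Ln ((1 + \<i> * of_real t) / (1 - \<i> * of_real t)) ^ a / fact a + X * mtlerch a X (\<i> * of_real t)"
      by blast
    have D2: "\<i> * of_real t * D = W \<theta> + X * mtlerch a X (\<i> * of_real t)"
      using D(2) Ln_moebius_i_tan[of \<theta>] th unfolding t_def W_def by auto
    have "((\<lambda>\<theta>. \<i> * of_real (tan (\<theta> / 2))) has_vector_derivative (\<i> * of_real t')) (at \<theta>)"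
      by (intro has_vector_derivative_mult_right has_vector_derivative_of_real dt)
    from field_vector_diff_chain_at[OF this D(1)[unfolded t_def]]
    have dP: "((\<lambda>\<theta>. mtlerch a X (\<i> * of_real (tan (\<theta> / 2)))) has_vector_derivative (\<i> * of_real t' * D)) (at \<theta>)"
      by (simp add: o_def)
    have "((\<lambda>z. (\<i> * z) ^ a / fact a) has_field_derivative \<i> * (\<i> * of_real \<theta>) ^ (a - 1) / fact (a - 1)) (at (of_real \<theta>))"
    proof -
      obtain b where b: "a = Suc b"
        using a gr0_implies_Suc by blast
      have "((\<lambda>z. (\<i> * z) ^ a / fact a) has_field_derivative
         (of_nat (Suc b) * (\<i> * of_real \<theta>) ^ b * \<i>) / fact (Suc b)) (at (of_real \<theta>))"
        unfolding b by (rule derivative_eq_intros refl)+ (simp_all del: of_nat_Suc fact_Suc)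
      also have "(of_nat (Suc b) * (\<i> * of_real \<theta>) ^ b * \<i>) / fact (Suc b) = \<i> * (\<i> * of_real \<theta>) ^ (a - 1) / fact (a - 1)"
        unfolding b fact_Suc using of_nat_neq_0[of b, where 'a = complex]
        by (simp add: mult_ac del: of_nat_Suc)
      finally show ?thesis .
    qed
    from has_vector_derivative_real_field[OF this]
    have dW: "(W has_vector_derivative \<i> * (\<i> * of_real \<theta>) ^ (a - 1) / fact (a - 1)) (at \<theta>)"
      unfolding W_def .
    have "((\<lambda>\<theta>. E \<theta> * (X * mtlerch a X (\<i> * of_real (tan (\<theta> / 2))) + W \<theta>)) has_vector_derivative
       (E \<theta> * (X * (\<i> * of_real t' * D) + \<i> * (\<i> * of_real \<theta>) ^ (a - 1) / fact (a - 1)) +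
        (- X * of_real (t' / t)) * E \<theta> * (X * mtlerch a X (\<i> * of_real (tan (\<theta> / 2))) + W \<theta>))) (at \<theta>)"
      by (intro has_vector_derivative_mult has_vector_derivative_add has_vector_derivative_mult_right dE dP dW)
    \<comment> \<open>The differential equation turns the derivative of P into a multiple of the
      bracket in \<open>K\<close>. It cancels against the derivative of \<open>E\<close>, and only
      the derivative of \<open>W\<close> survives.\<close>
    also have "\<i> * of_real t' * D = of_real (t' / t) * (W \<theta> + X * mtlerch a X (\<i> * of_real t))"
      unfolding D2[symmetric] using t by simp
    also have "E \<theta> * (X * (of_real (t' / t) * (W \<theta> + X * mtlerch a X (\<i> * of_real t))) + \<i> * (\<i> * of_real \<theta>) ^ (a - 1) / fact (a - 1)) +
        (- X * of_real (t' / t)) * E \<theta> * (X * mtlerch a X (\<i> * of_real (tan (\<theta> / 2))) + W \<theta>) =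
        E \<theta> * (\<i> * (\<i> * of_real \<theta>) ^ (a - 1) / fact (a - 1))"
      unfolding t_def[symmetric] by (simp only: algebra_simps) simp
    also have "\<dots> = (\<i> ^ a / fact (a - 1)) * (of_real \<theta> ^ (a - 1) * E \<theta>)"
      using power_Suc[of \<i> "a - 1"] a by (simp add: power_mult_distrib)
    finally show ?thesis
      by (rule has_vector_derivative_transform_within_open[of _ _ _ "{0<..}"]) (use th in \<open>auto simp: K_def\<close>)
  qed
  have cont: "continuous_on {0..pi / 2} K"
  proof (rule continuous_on_Icc_if_tendsto)
    have t_le: "0 < tan (\<theta> / 2)" "tan (\<theta> / 2) \<le> 1" if "\<theta> \<in> {0<..pi / 2}" for \<theta>
      using tan_half_in_unit[of \<theta>] that by (cases "\<theta> = pi / 2"; force simp: tan_45)+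
    have cos: "cos (\<theta> / 2) \<noteq> 0" if "\<theta> \<in> {0<..pi / 2}" for \<theta>
      using that cos_gt_zero_pi[of "\<theta> / 2"] by auto
    have "continuous_on {0<..pi / 2} (\<lambda>\<theta>. E \<theta> * (X * mtlerch a X (\<i> * of_real (tan (\<theta> / 2))) + W \<theta>))"
      unfolding E_def W_def
      by (intro continuous_intros continuous_on_compose2[OF continuous_on_mtlerch[OF a X]])
         (use t_le cos in \<open>force simp: norm_mult\<close>)+
    then show "continuous_on {0<..pi / 2} K"
      by (rule continuous_on_cong[THEN iffD1, rotated -1]) (auto simp: K_def)
    obtain C where C: "\<And>z. norm z \<le> 1 \<Longrightarrow> norm (mtlerch a X z) \<le> C * norm z"
      using norm_mtlerch_le[OF a X] by blast
    \<comment> \<open>\<open>C\<close> comes from the linear vanishing of P. The other summand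
      bounds \<open>W\<close> through \<open>\<theta> \<le> 2 * tan (\<theta> / 2)\<close> and
      \<open>\<theta> \<le> pi / 2\<close>.\<close>
    define M where "M = norm X * C + 2 * (pi / 2) ^ (a - 1)"
    have bound: "norm (K \<theta>) \<le> M * tan (\<theta> / 2) powr (1 - norm X)" if th: "\<theta> \<in> {0<..<pi / 2}" for \<theta>
    proof -
      define t where "t = tan (\<theta> / 2)"
      have t: "0 < t" "t < 1"
        using tan_half_in_unit[of \<theta>] th by (auto simp: t_def)
      have "arctan t = \<theta> / 2"
        unfolding t_def using th by (intro arctan_tan) auto
      then have th_le: "\<theta> \<le> 2 * t"
        using arctan_le_self[of t] t by simp
      \<comment> \<open>Since \<open>ln t\<close> is negative, replacing \<open>Re X\<close> by
        \<open>norm X\<close> only enlarges \<open>norm (E \<theta>)\<close>. Together with the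
        factor \<open>t\<close> the exponent becomes \<open>1 - norm X > 0\<close>, so
        \<open>K\<close> tends to 0.\<close>
      have "Re X * - ln t \<le> norm X * - ln t"
        using t by (intro mult_right_mono complex_Re_le_cmod) auto
      then have "norm (E \<theta>) \<le> t powr (- norm X)"
        using t by (simp add: E_def t_def powr_def)
      moreover have "norm (X * mtlerch a X (\<i> * of_real t) + W \<theta>) \<le> M * t"
      proof -
        have "norm (X * mtlerch a X (\<i> * of_real t)) \<le> norm X * (C * t)"
          using C[of "\<i> * of_real t"] t by (auto simp: norm_mult intro!: mult_left_mono)
        moreover have "norm (W \<theta>) \<le> 2 * (pi / 2) ^ (a - 1) * t"
        proof -
          have "norm (W \<theta>) = \<theta> ^ a / fact a"
            using th by (simp add: W_def norm_divide norm_mult norm_power)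
          also have "\<dots> \<le> \<theta> ^ a / 1"
            using th fact_ge_1[of a, where 'a = real] by (intro divide_left_mono) auto
          also have "\<dots> = \<theta> * \<theta> ^ (a - 1)"
            using a by (simp add: power_eq_if)
          also have "\<dots> \<le> (2 * t) * (pi / 2) ^ (a - 1)"
            using th th_le t by (intro mult_mono power_mono) auto
          finally show ?thesis by (simp add: mult_ac)
        qed
        ultimately have "norm (X * mtlerch a X (\<i> * of_real t)) + norm (W \<theta>) \<le> M * t"
          by (simp add: M_def algebra_simps)
        then show ?thesis
          using norm_triangle_ineq order_trans by blast
      qed
      ultimately have "norm (E \<theta> * (X * mtlerch a X (\<i> * of_real t) + W \<theta>)) \<le> t powr (- norm X) * (M * t)"
        unfolding norm_mult by (intro mult_mono) auto
      also have "\<dots> = M * (t powr (- norm X) * t powr 1)"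
        using t by simp
      also have "t powr (- norm X) * t powr 1 = t powr (1 - norm X)"
        unfolding powr_add[symmetric] by simp
      finally show ?thesis
        using th by (simp add: K_def t_def)
    qed
    have "((\<lambda>\<theta>. M * tan (\<theta> / 2) powr (1 - norm X)) \<longlongrightarrow> 0) (at_right 0)"
    proof (rule tendsto_mult_right_zero, rule tendsto_zero_powrI)
      have "isCont (\<lambda>\<theta>::real. tan (\<theta> / 2)) 0"
        by (intro continuous_intros) auto
      then show "((\<lambda>\<theta>::real. tan (\<theta> / 2)) \<longlongrightarrow> 0) (at_right 0)"
        by (simp add: isCont_def filterlim_at_split)
      show "\<forall>\<^sub>F \<theta> in at_right 0. 0 \<le> tan (\<theta> / 2 :: real)"
        unfolding eventually_at_right_field 
        by (intro exI[of _ "pi / 2"] conjI allI impI less_imp_le tan_half_in_unit(1)) simp_all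
    qed (use X in auto)
    moreover have "\<forall>\<^sub>F \<theta> in at_right 0. norm (K \<theta>) \<le> M * tan (\<theta> / 2) powr (1 - norm X)"
      unfolding eventually_at_right_field 
      by (intro exI[of _ "pi / 2"] conjI allI impI bound) simp_all
    ultimately have "(K \<longlongrightarrow> 0) (at_right 0)"
      by (rule Lim_null_comparison[rotated])
    then show "(K \<longlongrightarrow> K 0) (at_right 0)"
      by (simp add: K_def)
  qed
  have "((\<lambda>\<theta>. (\<i> ^ a / fact (a - 1)) * (of_real \<theta> ^ (a - 1) * E \<theta>)) has_integral (K (pi / 2) - K 0)) {0..pi / 2}"
    using deriv cont by (intro fundamental_theorem_of_calculus_interior) auto
  from has_integral_mult_right[OF this, of "fact (a - 1) / \<i> ^ a"]
  have "((\<lambda>\<theta>. of_real \<theta> ^ (a - 1) * E \<theta>) has_integral (fact (a - 1) / \<i> ^ a * (K (pi / 2) - K 0))) {0..pi / 2}"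
    by simp
  then show ?thesis
    by (simp add: K_def E_def W_def tan_45)
qed

section \<open>The integral along the unit arc\<close>

lemma moebius_notin_nonpos_Reals:
  fixes z :: complex
  assumes "norm z \<le> 1" "z \<noteq> 1" "z \<noteq> -1"
  shows "(1 + z) / (1 - z) \<notin> \<real>\<^sub>\<le>\<^sub>0"
proof
  assume le: "(1 + z) / (1 - z) \<in> \<real>\<^sub>\<le>\<^sub>0"
  have "(norm z)\<^sup>2 \<le> 1"
    using assms(1) by (simp add: power_le_one)
  then have "Re ((1 + z) / (1 - z)) \<ge> 0"
    by (simp add: Re_moebius_div_eq)
  \<comment> \<open>A nonpositive real number with nonnegative real part is 0. The point 1 must be
    excluded too, because there division by zero yields the value 0.\<close>
  with le have "(1 + z) / (1 - z) = 0"
    by (auto simp: complex_nonpos_Reals_iff complex_eq_iff)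
  then have "1 + z = 0"
    using assms(2) by simp
  with assms(3) show False
    by (simp add: add_eq_0_iff)
qed

lemma rcis_ne_one:
  assumes "0 < \<theta>" "\<theta> \<le> pi / 2" "0 \<le> r"
  shows "of_real r * cis \<theta> \<noteq> 1" "of_real r * cis \<theta> \<noteq> -1"
proof -
  have "sin \<theta> > 0" "cos \<theta> \<ge> 0"
    using assms by (auto intro!: sin_gt_zero cos_ge_zero)
  then show "of_real r * cis \<theta> \<noteq> 1" "of_real r * cis \<theta> \<noteq> -1"
    using assms(3) mult_nonneg_nonneg[of r "cos \<theta>"] by (auto simp: complex_eq_iff)
qed

text \<open>Along \<open>z = cis \<theta>\<close> the factor
  \<open>exp (- \<i> * of_real \<theta> * X)\<close> is the power of \<open>z\<close> with exponent
  \<open>- X\<close>, so \<open>G 1\<close> is the primitive of the overview.\<close>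

lemma has_integral_mtlerch_arc:
  fixes X :: complex
  assumes a: "a > 0" and X: "norm X < 1"
  shows "((\<lambda>\<theta>. exp (- \<i> * of_real \<theta> * X) * (of_real pi / 2 * \<i> - of_real (ln (tan (\<theta> / 2)))) ^ a) has_integral
    fact a / \<i> * (exp (- \<i> * of_real (pi / 2) * X) * mtlerch a X \<i> - mtlerch a X 1)) {0..pi / 2}"
proof -
  define G where "G = (\<lambda>r \<theta>. exp (- \<i> * of_real \<theta> * X) * mtlerch a X (of_real r * cis \<theta>))"
  define g where "g = (\<lambda>r \<theta>. \<i> * exp (- \<i> * of_real \<theta> * X) *
    (Ln ((1 + of_real r * cis \<theta>) / (1 - of_real r * cis \<theta>)) ^ a / fact a))"
  have dexp: "((\<lambda>\<theta>. exp (- \<i> * of_real \<theta> * X)) has_vector_derivative (- \<i> * X * exp (- \<i> * of_real \<theta> * X))) (at \<theta>)" for \<theta>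
    by (rule has_vector_derivative_real_field) (auto intro!: derivative_eq_intros)
  have dcis: "((\<lambda>\<theta>. of_real r * cis \<theta>) has_vector_derivative (\<i> * (of_real r * cis \<theta>))) (at \<theta>)" for r \<theta>
    unfolding cis_conv_exp by (rule has_vector_derivative_real_field) (auto intro!: derivative_eq_intros)
  have dG: "(G r has_vector_derivative g r \<theta>) (at \<theta>)" if r: "0 \<le> r" "r < 1" for r \<theta>
  proof -
    let ?z = "of_real r * cis \<theta>"
    have "norm ?z < 1"
      using r by (simp add: norm_mult)
    from mtlerch_has_field_derivative[OF a X this]
    obtain D where D: "(mtlerch a X has_field_derivative D) (at ?z)"
      "?z * D = Ln ((1 + ?z) / (1 - ?z)) ^ a / fact a + X * mtlerch a X ?z"
      by blast
    from field_vector_diff_chain_at[OF dcis D(1)]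
    have "((\<lambda>\<theta>. mtlerch a X (of_real r * cis \<theta>)) has_vector_derivative (\<i> * ?z * D)) (at \<theta>)"
      by (simp add: o_def)
    from has_vector_derivative_mult[OF dexp this]
    have "(G r has_vector_derivative (exp (- \<i> * of_real \<theta> * X) * (\<i> * (?z * D)) +
        - \<i> * X * exp (- \<i> * of_real \<theta> * X) * mtlerch a X ?z)) (at \<theta>)"
      unfolding G_def by (simp only: mult.assoc)
    also have "exp (- \<i> * of_real \<theta> * X) * (\<i> * (?z * D)) +
        - \<i> * X * exp (- \<i> * of_real \<theta> * X) * mtlerch a X ?z = g r \<theta>"
      unfolding D(2) g_def by (simp only: algebra_simps) simp
    finally show ?thesis .
  qed
  \<comment> \<open>A positive \<open>\<delta>\<close> keeps the sector away from 1, where the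
    logarithm is singular; joint continuity then holds up to radius 1.\<close>
  have cont_g: "continuous_on ({0..1} \<times> {\<delta>..\<theta>}) (\<lambda>(r, \<phi>). g r \<phi>)" if "0 < \<delta>" "\<theta> \<le> pi / 2" for \<delta> \<theta>
  proof -
    have "(1 + of_real r * cis \<phi>) / (1 - of_real r * cis \<phi>) \<notin> \<real>\<^sub>\<le>\<^sub>0"
      if "r \<in> {0..1}" "\<phi> \<in> {\<delta>..\<theta>}" for r \<phi>
      using that \<open>0 < \<delta>\<close> \<open>\<theta> \<le> pi / 2\<close> rcis_ne_one[of \<phi> r]
      by (intro moebius_notin_nonpos_Reals) (auto simp: norm_mult)
    moreover have "1 - of_real r * cis \<phi> \<noteq> 0" if "r \<in> {0..1}" "\<phi> \<in> {\<delta>..\<theta>}" for r \<phi>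
      using that \<open>0 < \<delta>\<close> \<open>\<theta> \<le> pi / 2\<close> rcis_ne_one[of \<phi> r] by auto
    ultimately show ?thesis
      unfolding g_def case_prod_unfold cis_conv_exp by (intro continuous_intros) auto
  qed
  have cont_G: "continuous_on {0..1} (\<lambda>r. G r \<phi>)" for \<phi>
    unfolding G_def
    by (intro continuous_intros continuous_on_compose2[OF continuous_on_mtlerch[OF a X]])
       (auto simp: norm_mult)
  \<comment> \<open>The series cannot be differentiated termwise on the unit circle, so work on the circle of radius \<open>r\<close> and let \<open>r\<close> tend to 1.\<close>
  have G_diff: "integral {\<delta>..\<theta>} (g 1) = G 1 \<theta> - G 1 \<delta>" if *: "0 < \<delta>" "\<delta> \<le> \<theta>" "\<theta> \<le> pi / 2" for \<delta> \<theta>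
  proof -
    have closure: "closure {0..<1} = {0..1::real}"
      by simp
    have cont_int: "continuous_on {0..1} (\<lambda>r. integral {\<delta>..\<theta>} (g r))"
      using integral_continuous_on_param[of "{0..1}" \<delta> \<theta> g] cont_g[OF *(1,3)]
      by (simp only: cbox_interval)
    have "integral {\<delta>..\<theta>} (g 1) - (G 1 \<theta> - G 1 \<delta>) = 0"
    proof (rule continuous_constant_on_closure[of "{0..<1::real}" "\<lambda>r. integral {\<delta>..\<theta>} (g r) - (G r \<theta> - G r \<delta>)"])
      show "continuous_on (closure {0..<1}) (\<lambda>r. integral {\<delta>..\<theta>} (g r) - (G r \<theta> - G r \<delta>))"
        unfolding closure by (intro continuous_on_diff cont_int cont_G)
      fix r :: real assume r: "r \<in> {0..<1}"
      have "(g r has_integral (G r \<theta> - G r \<delta>)) {\<delta>..\<theta>}"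
        using r * by (intro fundamental_theorem_of_calculus has_vector_derivative_at_within[OF dG]) auto
      then show "integral {\<delta>..\<theta>} (g r) - (G r \<theta> - G r \<delta>) = 0"
        by (simp add: integral_unique)
    qed (simp add: closure)
    then show ?thesis by simp
  qed
  \<comment> \<open>On the circle itself \<open>G 1\<close> is differentiable because, by
    \<open>G_diff\<close>, it is an integral of the continuous function \<open>g 1\<close> up to a
    constant.\<close>
  have deriv: "(G 1 has_vector_derivative g 1 \<theta>) (at \<theta>)" if th: "\<theta> \<in> {0<..<pi / 2}" for \<theta>
  proof -
    define \<delta> where "\<delta> = \<theta> / 2"
    have \<delta>: "0 < \<delta>" "\<delta> < \<theta>"
      using th by (auto simp: \<delta>_def)
    have "continuous_on {\<delta>..pi / 2} (\<lambda>\<phi>. (1::real, \<phi>))"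
      by (intro continuous_intros)
    moreover have "(\<lambda>\<phi>. (1::real, \<phi>)) ` {\<delta>..pi / 2} \<subseteq> {0..1} \<times> {\<delta>..pi / 2}"
      by auto
    ultimately have "continuous_on {\<delta>..pi / 2} (\<lambda>\<phi>. case (1, \<phi>) of (r, \<phi>) \<Rightarrow> g r \<phi>)"
      by (rule continuous_on_compose2[OF cont_g[OF \<delta>(1) order_refl]])
    then have "continuous_on {\<delta>..pi / 2} (g 1)"
      by simp
    from integral_has_vector_derivative[OF this, of \<theta>]
    have "((\<lambda>u. integral {\<delta>..u} (g 1)) has_vector_derivative g 1 \<theta>) (at \<theta>)"
      using \<delta> th at_within_Icc_at[of \<delta> \<theta> "pi / 2"] by simp
    then have "((\<lambda>u. G 1 \<delta> + integral {\<delta>..u} (g 1)) has_vector_derivative (0 + g 1 \<theta>)) (at \<theta>)"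
      by (intro has_vector_derivative_add has_vector_derivative_const)
    then have "((\<lambda>u. G 1 \<delta> + integral {\<delta>..u} (g 1)) has_vector_derivative g 1 \<theta>) (at \<theta>)"
      by simp
    then show ?thesis
      by (rule has_vector_derivative_transform_within_open[of _ _ _ "{\<delta><..<pi / 2}"])
         (use th \<delta> G_diff in auto)
  qed
  have "continuous_on {0..pi / 2} (G 1)"
    unfolding G_def cis_conv_exp
    by (intro continuous_intros continuous_on_compose2[OF continuous_on_mtlerch[OF a X]])
       (auto simp: norm_mult)
  \<comment> \<open>Continuity of P at 1 absorbs the logarithmic singularity at angle 0.\<close>
  then have int: "(g 1 has_integral (G 1 (pi / 2) - G 1 0)) {0..pi / 2}"
    using deriv by (intro fundamental_theorem_of_calculus_interior) auto
  have int': "((\<lambda>\<theta>. fact a / \<i> * g 1 \<theta>) has_integral (fact a / \<i> * (G 1 (pi / 2) - G 1 0))) {0..pi / 2}"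
    by (rule has_integral_mult_right[OF int])
  have "((\<lambda>\<theta>. exp (- \<i> * of_real \<theta> * X) * (of_real pi / 2 * \<i> - of_real (ln (tan (\<theta> / 2)))) ^ a) has_integral
      (fact a / \<i> * (G 1 (pi / 2) - G 1 0))) {0..pi / 2}"
  \<comment> \<open>At 0 both integrands have only default values, so this point is removed as a
    negligible set.\<close>
  proof (rule has_integral_spike[OF negligible_sing[of 0] _ int'])
    fix \<theta> :: real assume "\<theta> \<in> {0..pi / 2} - {0}"
    then have "Ln ((1 + cis \<theta>) / (1 - cis \<theta>)) = of_real pi / 2 * \<i> - of_real (ln (tan (\<theta> / 2)))"
      by (intro Ln_moebius_cis) auto
    then show "exp (- \<i> * of_real \<theta> * X) * (of_real pi / 2 * \<i> - of_real (ln (tan (\<theta> / 2)))) ^ a =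
        fact a / \<i> * g 1 \<theta>"
      by (simp add: g_def)
  qed
  then show ?thesis
    by (simp add: G_def)
qed

subsection \<open>The generating function of the T-values\<close>

text \<open>Cauchy product of the Bernoulli series at \<open>w * X\<close> with the series of
  T-values. The exponent of \<open>w\<close> is one below the Bernoulli index, which accounts for
  the factor \<open>1 / w\<close> and, at \<open>k = b\<close>, for the negative power.\<close>

lemma sums_bernoulli_mtv:
  fixes X :: complex
  assumes a: "a > 0" and X: "norm X < 1"
  shows "(\<lambda>n. let b = Suc n in
            - 2 * (\<Sum>k = 1..b. of_real (bernoulli_num (b - k)) / fact (b - k) *
                     (- of_real pi * \<i>) powi (int b - int k - 1) *
                     of_real (mtv (replicate (a - 1) 1 @ [k + 1])) * X ^ b))
         sums (- 2 * X / (exp (- of_real pi * \<i> * X) - 1) * (X * mtlerch a X 1))"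
proof -
  define w :: complex where "w = - of_real pi * \<i>"
  have w: "w \<noteq> 0" by (simp add: w_def)
  define \<beta> where "\<beta> = (\<lambda>j. of_real (bernoulli_num j) / fact j * (w * X) ^ j)"
  define t where "t = (\<lambda>i. of_real (mtv (replicate (a - 1) 1 @ [Suc i + 1])) * X ^ Suc i)"
  have "norm (w * X) < 2 * pi"
  proof -
    have "norm (w * X) = pi * norm X"
      by (simp add: w_def norm_mult)
    also have "\<dots> \<le> pi * 1"
      using X by (intro mult_left_mono) auto
    finally show ?thesis using pi_gt_zero by linarith
  qed
  note bern = bernoulli_genfun[OF this]
  have \<beta>: "summable (\<lambda>n. norm (\<beta> n))"
    "suminf \<beta> = (if w * X = 0 then 1 else w * X / (exp (w * X) - 1))"
    using bern(1) sums_unique[OF bern(2)] unfolding \<beta>_def by simp_all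
  have t: "summable (\<lambda>n. norm (t n))" "suminf t = X * mtlerch a X 1"
    using mtv_genfun(1)[OF a X] sums_unique[OF mtv_genfun(2)[OF a X]] unfolding t_def by simp_all
  from Cauchy_product_sums[OF \<beta>(1) t(1)]
  have "(\<lambda>n. \<Sum>i\<le>n. \<beta> i * t (n - i)) sums
      ((if w * X = 0 then 1 else w * X / (exp (w * X) - 1)) * (X * mtlerch a X 1))"
    unfolding \<beta>(2) t(2) .
  from sums_mult[OF this, of "- 2 / w"]
  have "(\<lambda>n. - 2 / w * (\<Sum>i\<le>n. \<beta> i * t (n - i))) sums
      (- 2 / w * ((if w * X = 0 then 1 else w * X / (exp (w * X) - 1)) * (X * mtlerch a X 1)))" .
  also have "- 2 / w * ((if w * X = 0 then 1 else w * X / (exp (w * X) - 1)) * (X * mtlerch a X 1)) =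
      - 2 * X / (exp (w * X) - 1) * (X * mtlerch a X 1)"
    \<comment> \<open>At \<open>X = 0\<close> both sides vanish, the right one also through division
      by \<open>exp 0 - 1 = 0\<close>.\<close>
    using w by (cases "X = 0") auto
  also have "(\<lambda>n. - 2 / w * (\<Sum>i\<le>n. \<beta> i * t (n - i))) = (\<lambda>n. let b = Suc n in
            - 2 * (\<Sum>k = 1..b. of_real (bernoulli_num (b - k)) / fact (b - k) *
                     w powi (int b - int k - 1) *
                     of_real (mtv (replicate (a - 1) 1 @ [k + 1])) * X ^ b))"
  proof
    fix n
    have "(\<Sum>i\<le>n. \<beta> i * t (n - i)) / w = (\<Sum>k = 1..Suc n. of_real (bernoulli_num (Suc n - k)) / fact (Suc n - k) *
                     w powi (int (Suc n) - int k - 1) *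
                     of_real (mtv (replicate (a - 1) 1 @ [k + 1])) * X ^ Suc n)"
      unfolding sum_divide_distrib
    proof (rule sum.reindex_bij_witness[of _ "\<lambda>k. Suc n - k" "\<lambda>i. Suc n - i"])
      fix i assume "i \<in> {..n}"
      then have i: "i \<le> n" by simp
      have "int (Suc n) - int (Suc n - i) - 1 = int i - 1"
        using i by simp
      moreover have "w powi (int i - 1) = w ^ i / w"
        using w by (simp add: power_int_diff)
      moreover have "X ^ Suc n = X ^ i * X ^ Suc (n - i)"
        using i by (simp flip: power_add)
      moreover have "Suc n - (Suc n - i) = i" "Suc n - i = Suc (n - i)"
        using i by auto
      ultimately show "of_real (bernoulli_num (Suc n - (Suc n - i))) / fact (Suc n - (Suc n - i)) *
          w powi (int (Suc n) - int (Suc n - i) - 1) *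
          of_real (mtv (replicate (a - 1) 1 @ [Suc n - i + 1])) * X ^ Suc n = \<beta> i * t (n - i) / w"
        by (auto simp: \<beta>_def t_def power_mult_distrib mult_ac)
    qed auto
    then show "- 2 / w * (\<Sum>i\<le>n. \<beta> i * t (n - i)) = (let b = Suc n in
            - 2 * (\<Sum>k = 1..b. of_real (bernoulli_num (b - k)) / fact (b - k) *
                     w powi (int b - int k - 1) *
                     of_real (mtv (replicate (a - 1) 1 @ [k + 1])) * X ^ b))"
      unfolding Let_def by (metis times_divide_eq_left times_divide_eq_right)
  qed
  finally show ?thesis
    unfolding w_def .
qed

section \<open>Combining the two integrals with the generating function\<close>

lemma exp_minus_pi_i_ne_1:
  fixes X :: complex
  assumes "X \<noteq> 0" "norm X < 1"
  shows "exp (- of_real pi * \<i> * X) \<noteq> 1"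
proof
  assume "exp (- of_real pi * \<i> * X) = 1"
  then obtain n :: int where n: "Re (- of_real pi * \<i> * X) = 0" "Im (- of_real pi * \<i> * X) = of_int (2 * n) * pi"
    unfolding exp_eq_1 by blast
  have Im: "Im X = 0"
    using n(1) by simp
  have "pi * (Re X + 2 * of_int n) = 0"
    using n(2) by (simp add: algebra_simps)
  then have Re: "Re X = - 2 * of_int n"
    by simp
  have "\<bar>Re X\<bar> < 1"
    using assms(2) abs_Re_le_cmod[of X] by linarith
  with Re have "n = 0"
    by auto
  with Re Im assms(1) show False
    by (simp add: complex_eq_iff)
qed

text \<open>Integrability is asserted as well, since \<open>integral\<close> is 0 on functions that
  are not integrable. At \<open>X = 0\<close> the second integrand is 0 by division by zero, in
  agreement with its limit.\<close>

theorem theorem5: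
  fixes a :: nat and X :: complex
  assumes "a \<ge> 1" and "norm X < 1"
  shows "(\<lambda>\<theta>::real. of_real \<theta> ^ (a - 1) * exp (- X * of_real (ln (tan (\<theta> / 2)))))
           integrable_on {0..pi / 2}
    \<and> (\<lambda>\<theta>::real. 2 * X ^ 2 * exp (- \<i> * of_real \<theta> * X) / (exp (- of_real pi * \<i> * X) - 1) *
              (of_real pi / 2 * \<i> - of_real (ln (tan (\<theta> / 2)))) ^ a)
           integrable_on {0..pi / 2}
    \<and> (\<lambda>n. let b = Suc n in
            - 2 * (\<Sum>k = 1..b. of_real (bernoulli_num (b - k)) / fact (b - k) *
                     (- of_real pi * \<i>) powi (int b - int k - 1) *
                     of_real (mtv (replicate (a - 1) 1 @ [k + 1])) * X ^ b))
         sums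
         (\<i> ^ (a - 1) / fact (a - 1) * X_csc X *
            integral {0..pi / 2}
              (\<lambda>\<theta>::real. of_real \<theta> ^ (a - 1) * exp (- X * of_real (ln (tan (\<theta> / 2)))))
          + \<i> / fact a *
            integral {0..pi / 2}
              (\<lambda>\<theta>::real. 2 * X ^ 2 * exp (- \<i> * of_real \<theta> * X) / (exp (- of_real pi * \<i> * X) - 1) *
                 (of_real pi / 2 * \<i> - of_real (ln (tan (\<theta> / 2)))) ^ a)
          + \<i> * ((\<i> * of_real pi / 2) ^ a / fact a) * X_csc X)"
proof -
  have a: "a > 0" using assms(1) by simp
  note X = assms(2)
  \<comment> \<open>The power of \<open>\<i>\<close> with exponent \<open>- X\<close>; both the sine
    and the exponential in the denominator are rational in \<open>e\<close>.\<close>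
  define e where "e = exp (- \<i> * of_real (pi / 2) * X)"
  define W where "W = (\<i> * of_real pi / 2) ^ a / fact a"
  define P where "P = mtlerch a X"
  have ee: "exp (- of_real pi * \<i> * X) = e ^ 2"
    unfolding e_def by (simp add: mult_ac flip: exp_double)
  note I = has_integral_mtlerch_imaginary_axis[OF a X, folded W_def P_def]
  have "(\<lambda>\<theta>. 2 * X ^ 2 / (e ^ 2 - 1) * (exp (- \<i> * of_real \<theta> * X) *
      (of_real pi / 2 * \<i> - of_real (ln (tan (\<theta> / 2)))) ^ a)) =
    (\<lambda>\<theta>. 2 * X ^ 2 * exp (- \<i> * of_real \<theta> * X) / (e ^ 2 - 1) *
              (of_real pi / 2 * \<i> - of_real (ln (tan (\<theta> / 2)))) ^ a)"
    by (simp add: fun_eq_iff)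
  with has_integral_mult_right[OF has_integral_mtlerch_arc[OF a X, folded e_def P_def], of "2 * X ^ 2 / (e ^ 2 - 1)"]
  have J: "((\<lambda>\<theta>. 2 * X ^ 2 * exp (- \<i> * of_real \<theta> * X) / (e ^ 2 - 1) *
              (of_real pi / 2 * \<i> - of_real (ln (tan (\<theta> / 2)))) ^ a)
      has_integral (2 * X ^ 2 / (e ^ 2 - 1) * (fact a / \<i> * (e * P \<i> - P 1)))) {0..pi / 2}"
    by simp
  have "\<i> ^ (a - 1) / fact (a - 1) * X_csc X * (fact (a - 1) / \<i> ^ a * (X * P \<i> + W))
      + \<i> / fact a * (2 * X ^ 2 / (e ^ 2 - 1) * (fact a / \<i> * (e * P \<i> - P 1)))
      + \<i> * W * X_csc X = - 2 * X / (e ^ 2 - 1) * (X * P 1)" (is "?A + ?B + ?C = _")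
  proof -
    have "\<i> ^ a = \<i> * \<i> ^ (a - 1)"
      using a by (simp add: power_eq_if)
    then have A: "?A = - \<i> * X_csc X * (X * P \<i> + W)"
      by simp
    have cancel: "\<i> / F * (c * (F / \<i> * y)) = c * y" if "F \<noteq> 0" for F c y :: complex
    proof -
      have "\<i> / F * (c * (F / \<i> * y)) = (\<i> / \<i>) * (F / F) * (c * y)"
        by (simp only: divide_inverse mult_ac)
      with that show ?thesis by simp
    qed
    have B: "?B = 2 * X ^ 2 / (e ^ 2 - 1) * (e * P \<i> - P 1)"
      by (rule cancel) simp
    \<comment> \<open>The boundary term \<open>W\<close> of the first integral cancels the third
      summand of the formula.\<close>
    have "?A + ?B + ?C = - \<i> * X_csc X * X * P \<i> + 2 * X ^ 2 / (e ^ 2 - 1) * (e * P \<i> - P 1)"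
      unfolding A B by (simp add: algebra_simps)
    also have "\<dots> = - 2 * X / (e ^ 2 - 1) * (X * P 1)"
    proof (cases "X = 0")
      case False
      have ne: "e ^ 2 - 1 \<noteq> 0"
        using exp_minus_pi_i_ne_1[OF False X] unfolding ee by simp
      have e: "e \<noteq> 0" by (simp add: e_def)
      have "exp (\<i> * (of_real pi * X / 2)) = inverse e" "exp (- (\<i> * (of_real pi * X / 2))) = e"
        by (simp_all add: e_def exp_minus mult_ac)
      then have sin: "sin (of_real pi * X / 2) = (inverse e - e) / (2 * \<i>)"
        unfolding sin_exp_eq by simp
      have "inverse e - e = (1 - e ^ 2) / e"
        using e by (simp add: field_simps power2_eq_square)
      then have "X_csc X = X / ((1 - e ^ 2) / e / (2 * \<i>))"
        using False by (simp only: X_csc_def if_False sin)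
      \<comment> \<open>With this value the two terms containing \<open>P \<i>\<close> cancel,
        leaving only \<open>P 1\<close>.\<close>
      then have "- \<i> * X_csc X = 2 * e * X / (1 - e ^ 2)"
        by simp
      also have "\<dots> = - (2 * e * X / (e ^ 2 - 1))"
        by (metis minus_diff_eq minus_divide_right)
      finally show ?thesis
        by (simp add: power2_eq_square algebra_simps diff_divide_distrib)
    qed simp
    finally show ?thesis .
  qed
  then show ?thesis
    using sums_bernoulli_mtv[OF a X] I J unfolding ee W_def[symmetric] P_def[symmetric]
    by (auto simp only: has_integral_integrable integral_unique intro!: conjI)
qed

end
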